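(* Let $A=(a_{ij})_{i,j\in I}$ be a symmetrized Borcherds Cartan matrix with $a_{ii}\le 0$ for all $i\in I$. Let $J=\{j\in I: a_{jj}=0\}$ and assume that, for $i,j\in I$, $a_{ij}=0$ if and only if $i,j\in J$. Then, given any total ordering $\le$ on $J$, there are free Lie subalgebras $\mathfrak u^+$ and $\mathfrak u^-$ of $\mathfrak g=\mathfrak g(A)$ with free generating sets $$U^+=\{\operatorname{ad}(e_{j_1})^{\ell_1}\cdots\operatorname{ad}(e_{j_n})^{\ell_n}e_i : n\ge 0,\ j_1<\dots<j_n\in J,\ \ell_k>0,\ i\in I\setminus J\},$$ $$U^-=\{\operatorname{ad}(f_{j_1})^{\ell_1}\cdots\operatorname{ad}(f_{j_n})^{\ell_n}f_i : n\ge 0,\ j_1<\dots<j_n\in J,\ \ell_k>0,\ i\in I\setminus J\},$$ respectively. Furthermore, as vector spaces, $$\mathfrak g(A)=\mathfrak u^-\oplus(\mathfrak g_J+\mathfrak h)\oplus\mathfrak u^+,$$ where $\mathfrak g_J$ is the Borcherds algebra associated to the matrix $(a_{ij})_{i,j\in J}$.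
   Context: All Lie algebras are over $\mathbb C$. Let $I$ be a countable index set. A real matrix $A=(a_{ij})_{i,j\in I}$ is a symmetrized Borcherds Cartan matrix if it is symmetric, $a_{ij}\le 0$ whenever $i\ne j$, and $2a_{ij}/a_{ii}\in\mathbb Z$ for all $j\in I$ whenever $a_{ii}>0$. The Borcherds algebra $\mathfrak g(A)$ associated to $A$ is the Lie algebra with generators $\{e_i,f_i,h_i\}_{i\in I}$ and relations: $[h_i,h_j]=0$, $[h_i,e_j]=a_{ij}e_j$, $[h_i,f_j]=-a_{ij}f_j$, $[e_i,f_j]=\delta_{ij}h_i$ for all $i,j\in I$; $(\operatorname{ad}e_i)^{1-2a_{ij}/a_{ii}}e_j=0$ and $(\operatorname{ad}f_i)^{1-2a_{ij}/a_{ii}}f_j=0$ for all $i\neq j$ with $a_{ii}>0$; $[e_i,e_j]=0$ and $[f_i,f_j]=0$ for all $i,j\in I$ with $a_{ij}=0$. The subalgebra $\mathfrak h\subseteq\mathfrak g(A)$ is abelian with basis $\{h_i\}_{i\in I}$. $\mathfrak g_J$ is regarded as the subalgebra of $\mathfrak g(A)$ generated by $\{e_j,f_j,h_j\}_{j\in J}$ via the obvious identification of generators. *)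

theory Defs
  imports "HOL-Algebra.Algebraic_Closure_Type" "HOL-Library.Countable_Set"
    Complex_Main
begin

section \<open>Lie algebras over the complex numbers\<close>

abbreviation complex_field :: "complex ring"
  where "complex_field \<equiv> ring_of_type_algebra"

text \<open>
  As for modules in HOL-Algebra, the multiplicative part (\<open>mult\<close> and \<open>one\<close>) of the underlying
  ring record is not used.
\<close>

record ('a, 'b) lie = "('a, 'b) module" +
  lie_bracket :: "['b, 'b] \<Rightarrow> 'b"

locale lie_algebra = module complex_field L for L :: "(complex, 'b) lie" (structure) +
  assumes bracket_closed:
      "\<lbrakk>x \<in> carrier L; y \<in> carrier L\<rbrakk> \<Longrightarrow> lie_bracket L x y \<in> carrier L"
    and bracket_add_left:
      "\<lbrakk>x \<in> carrier L; y \<in> carrier L; z \<in> carrier L\<rbrakk> \<Longrightarrow>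
        lie_bracket L (x \<oplus> y) z = lie_bracket L x z \<oplus> lie_bracket L y z"
    and bracket_add_right:
      "\<lbrakk>x \<in> carrier L; y \<in> carrier L; z \<in> carrier L\<rbrakk> \<Longrightarrow>
        lie_bracket L x (y \<oplus> z) = lie_bracket L x y \<oplus> lie_bracket L x z"
    and bracket_smult_left:
      "\<lbrakk>x \<in> carrier L; y \<in> carrier L\<rbrakk> \<Longrightarrow> lie_bracket L (c \<odot> x) y = c \<odot> lie_bracket L x y"
    and bracket_smult_right:
      "\<lbrakk>x \<in> carrier L; y \<in> carrier L\<rbrakk> \<Longrightarrow> lie_bracket L x (c \<odot> y) = c \<odot> lie_bracket L x y"
    and bracket_self: "x \<in> carrier L \<Longrightarrow> lie_bracket L x x = \<zero>"
    and jacobi: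
      "\<lbrakk>x \<in> carrier L; y \<in> carrier L; z \<in> carrier L\<rbrakk> \<Longrightarrow>
        lie_bracket L x (lie_bracket L y z) \<oplus>
        (lie_bracket L y (lie_bracket L z x) \<oplus> lie_bracket L z (lie_bracket L x y)) = \<zero>"

definition lie_subalgebra :: "'b set \<Rightarrow> (complex, 'b) lie \<Rightarrow> bool"
  where "lie_subalgebra H L \<longleftrightarrow>
    submodule H complex_field L \<and> (\<forall>x\<in>H. \<forall>y\<in>H. lie_bracket L x y \<in> H)"

definition lie_generate :: "(complex, 'b) lie \<Rightarrow> 'b set \<Rightarrow> 'b set"
  where "lie_generate L S = \<Inter>{H. lie_subalgebra H L \<and> S \<subseteq> H}"

definition lie_hom :: "(complex, 'b) lie \<Rightarrow> (complex, 'c) lie \<Rightarrow> ('b \<Rightarrow> 'c) set"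
  where "lie_hom L M = {\<phi> \<in> carrier L \<rightarrow> carrier M.
    (\<forall>x\<in>carrier L. \<forall>y\<in>carrier L. \<phi> (x \<oplus>\<^bsub>L\<^esub> y) = \<phi> x \<oplus>\<^bsub>M\<^esub> \<phi> y) \<and>
    (\<forall>c. \<forall>x\<in>carrier L. \<phi> (c \<odot>\<^bsub>L\<^esub> x) = c \<odot>\<^bsub>M\<^esub> \<phi> x) \<and>
    (\<forall>x\<in>carrier L. \<forall>y\<in>carrier L. \<phi> (lie_bracket L x y) = lie_bracket M (\<phi> x) (\<phi> y))}"

definition lie_iso :: "(complex, 'b) lie \<Rightarrow> (complex, 'c) lie \<Rightarrow> ('b \<Rightarrow> 'c) set"
  where "lie_iso L M = {\<phi> \<in> lie_hom L M. bij_betw \<phi> (carrier L) (carrier M)}"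

definition internal_direct_sum3 ::
    "(complex, 'b) lie \<Rightarrow> 'b set \<Rightarrow> 'b set \<Rightarrow> 'b set \<Rightarrow> bool"
  where "internal_direct_sum3 L U V W \<longleftrightarrow>
    submodule U complex_field L \<and> submodule V complex_field L \<and> submodule W complex_field L \<and>
    bij_betw (\<lambda>(u, v, w). u \<oplus>\<^bsub>L\<^esub> v \<oplus>\<^bsub>L\<^esub> w) (U \<times> V \<times> W) (carrier L)"


section \<open>Lie algebras given by generators and relations\<close>

text \<open>
  The Lie algebra presented by a set \<open>S\<close> of generators and a set \<open>R\<close> of equations between Lie
  expressions in \<open>S\<close> consists of the Lie expressions in \<open>S\<close>, modulo the congruence generated by
  the Lie algebra axioms and \<open>R\<close>. Its universal property is proved below.
\<close>

datatype (set_lie_term: 'x) lie_term =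
    LGen 'x
  | LZero
  | LAdd "'x lie_term" "'x lie_term"
  | LScale complex "'x lie_term"
  | LBracket "'x lie_term" "'x lie_term"

inductive lie_cong ::
    "('x lie_term \<times> 'x lie_term) set \<Rightarrow> 'x lie_term \<Rightarrow> 'x lie_term \<Rightarrow> bool"
  for R where
  rel: "(s, t) \<in> R \<Longrightarrow> lie_cong R s t"
| refl: "lie_cong R s s"
| sym: "lie_cong R s t \<Longrightarrow> lie_cong R t s"
| trans: "lie_cong R s t \<Longrightarrow> lie_cong R t u \<Longrightarrow> lie_cong R s u"
| cong_add: "lie_cong R s s' \<Longrightarrow> lie_cong R t t' \<Longrightarrow> lie_cong R (LAdd s t) (LAdd s' t')"
| cong_scale: "lie_cong R s s' \<Longrightarrow> lie_cong R (LScale c s) (LScale c s')"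
| cong_bracket:
    "lie_cong R s s' \<Longrightarrow> lie_cong R t t' \<Longrightarrow> lie_cong R (LBracket s t) (LBracket s' t')"
| add_assoc: "lie_cong R (LAdd (LAdd s t) u) (LAdd s (LAdd t u))"
| add_comm: "lie_cong R (LAdd s t) (LAdd t s)"
| add_zero: "lie_cong R (LAdd LZero s) s"
| add_inv: "lie_cong R (LAdd (LScale (-1) s) s) LZero"
| scale_one: "lie_cong R (LScale 1 s) s"
| scale_scale: "lie_cong R (LScale c (LScale d s)) (LScale (c * d) s)"
| scale_add_left: "lie_cong R (LScale (c + d) s) (LAdd (LScale c s) (LScale d s))"
| scale_add_right: "lie_cong R (LScale c (LAdd s t)) (LAdd (LScale c s) (LScale c t))"
| bracket_add_left: "lie_cong R (LBracket (LAdd s t) u) (LAdd (LBracket s u) (LBracket t u))"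
| bracket_add_right: "lie_cong R (LBracket u (LAdd s t)) (LAdd (LBracket u s) (LBracket u t))"
| bracket_scale_left: "lie_cong R (LBracket (LScale c s) t) (LScale c (LBracket s t))"
| bracket_scale_right: "lie_cong R (LBracket s (LScale c t)) (LScale c (LBracket s t))"
| bracket_self: "lie_cong R (LBracket s s) LZero"
| jacobi: "lie_cong R (LAdd (LBracket s (LBracket t u))
      (LAdd (LBracket t (LBracket u s)) (LBracket u (LBracket s t)))) LZero"

definition lie_terms :: "'x set \<Rightarrow> 'x lie_term set"
  where "lie_terms S = {t. set_lie_term t \<subseteq> S}"

definition lie_cong_on ::
    "'x set \<Rightarrow> ('x lie_term \<times> 'x lie_term) set \<Rightarrow> ('x lie_term \<times> 'x lie_term) set"
  where "lie_cong_on S R = {(s, t). s \<in> lie_terms S \<and> t \<in> lie_terms S \<and> lie_cong R s t}"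

definition lie_class ::
    "'x set \<Rightarrow> ('x lie_term \<times> 'x lie_term) set \<Rightarrow> 'x lie_term \<Rightarrow> 'x lie_term set"
  where "lie_class S R t = lie_cong_on S R `` {t}"

definition presented_lie ::
    "'x set \<Rightarrow> ('x lie_term \<times> 'x lie_term) set \<Rightarrow> (complex, 'x lie_term set) lie"
  where "presented_lie S R =
    \<lparr>carrier = lie_terms S // lie_cong_on S R,
     monoid.mult = undefined,
     one = undefined,
     ring.zero = lie_class S R LZero,
     add = (\<lambda>x y. \<Union>s\<in>x. \<Union>t\<in>y. lie_class S R (LAdd s t)),
     module.smult = (\<lambda>c x. \<Union>s\<in>x. lie_class S R (LScale c s)),
     lie_bracket = (\<lambda>x y. \<Union>s\<in>x. \<Union>t\<in>y. lie_class S R (LBracket s t))\<rparr>"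

abbreviation free_lie :: "'x set \<Rightarrow> (complex, 'x lie_term set) lie"
  where "free_lie S \<equiv> presented_lie S {}"

definition free_lie_subalgebra :: "(complex, 'b) lie \<Rightarrow> 'b set \<Rightarrow> 'b set \<Rightarrow> bool"
  where "free_lie_subalgebra L H U \<longleftrightarrow>
    lie_subalgebra H L \<and> U \<subseteq> H \<and>
    (\<exists>\<phi> \<in> lie_iso (free_lie U) (L\<lparr>carrier := H\<rparr>). \<forall>u\<in>U. \<phi> (lie_class U {} (LGen u)) = u)"


subsection \<open>The presented Lie algebra and its universal property\<close>

lemma lie_terms_simps [simp]:
  "LGen x \<in> lie_terms S \<longleftrightarrow> x \<in> S"
  "LZero \<in> lie_terms S"
  "LAdd s t \<in> lie_terms S \<longleftrightarrow> s \<in> lie_terms S \<and> t \<in> lie_terms S"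
  "LScale c s \<in> lie_terms S \<longleftrightarrow> s \<in> lie_terms S"
  "LBracket s t \<in> lie_terms S \<longleftrightarrow> s \<in> lie_terms S \<and> t \<in> lie_terms S"
  by (auto simp: lie_terms_def)

lemma equiv_lie_cong_on: "equiv (lie_terms S) (lie_cong_on S R)"
  by (rule equivI)
    (auto simp: lie_cong_on_def refl_on_def intro!: symI transI
      intro: lie_cong.refl lie_cong.sym lie_cong.trans)

lemma lie_class_eq_iff:
  assumes "s \<in> lie_terms S" "t \<in> lie_terms S"
  shows "lie_class S R s = lie_class S R t \<longleftrightarrow> lie_cong R s t"
  unfolding lie_class_def eq_equiv_class_iff[OF equiv_lie_cong_on assms]
  using assms by (simp add: lie_cong_on_def)

lemma carrier_presented_lie: "carrier (presented_lie S R) = lie_class S R ` lie_terms S"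
  by (auto simp: presented_lie_def quotient_def lie_class_def)

lemma presented_lie_class [simp]:
  assumes "s \<in> lie_terms S"
  shows "lie_class S R s \<in> carrier (presented_lie S R)"
  using assms by (simp add: carrier_presented_lie)

lemma presented_lie_zero: "\<zero>\<^bsub>presented_lie S R\<^esub> = lie_class S R LZero"
  by (simp add: presented_lie_def)

lemma presented_lie_ops:
  fixes s t :: "'x lie_term"
  assumes "s \<in> lie_terms S" "t \<in> lie_terms S"
  shows "lie_class S R s \<oplus>\<^bsub>presented_lie S R\<^esub> lie_class S R t = lie_class S R (LAdd s t)"
    and "c \<odot>\<^bsub>presented_lie S R\<^esub> lie_class S R s = lie_class S R (LScale c s)"
    and "lie_bracket (presented_lie S R) (lie_class S R s) (lie_class S R t) =
      lie_class S R (LBracket s t)"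
proof -
  have mem: "u' \<in> lie_class S R u \<longleftrightarrow> u' \<in> lie_terms S \<and> lie_cong R u u'"
    if "u \<in> lie_terms S" for u u'
    using that by (auto simp: lie_class_def lie_cong_on_def)
  have self: "u \<in> lie_class S R u" if "u \<in> lie_terms S" for u
    using that by (simp add: mem lie_cong.refl)
  have UN_const_eq: "(\<Union>x\<in>M. h x) = c" if "a \<in> M" "\<And>x. x \<in> M \<Longrightarrow> h x = c"
    for a M c and h :: "'x lie_term \<Rightarrow> 'x lie_term set"
    using that by blast
  have "lie_class S R (LAdd s' t') = lie_class S R (LAdd s t)"
    if "s' \<in> lie_class S R s" "t' \<in> lie_class S R t" for s' t'
    using that assms
    by (auto simp: mem lie_class_eq_iff intro: lie_cong.cong_add lie_cong.sym)
  then show "lie_class S R s \<oplus>\<^bsub>presented_lie S R\<^esub> lie_class S R t = lie_class S R (LAdd s t)"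
    unfolding presented_lie_def lie.simps module.simps ring.simps
    by (intro UN_const_eq[OF self] assms)
  have "lie_class S R (LScale c s') = lie_class S R (LScale c s)"
    if "s' \<in> lie_class S R s" for s'
    using that assms
    by (auto simp: mem lie_class_eq_iff intro: lie_cong.cong_scale lie_cong.sym)
  then show "c \<odot>\<^bsub>presented_lie S R\<^esub> lie_class S R s = lie_class S R (LScale c s)"
    unfolding presented_lie_def module.simps
    by (intro UN_const_eq[OF self] assms)
  have "lie_class S R (LBracket s' t') = lie_class S R (LBracket s t)"
    if "s' \<in> lie_class S R s" "t' \<in> lie_class S R t" for s' t'
    using that assms
    by (auto simp: mem lie_class_eq_iff intro: lie_cong.cong_bracket lie_cong.sym)
  then show "lie_bracket (presented_lie S R) (lie_class S R s) (lie_class S R t) =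
      lie_class S R (LBracket s t)"
    unfolding presented_lie_def lie.simps module.simps ring.simps
    by (intro UN_const_eq[OF self] assms)
qed

lemma complex_field_simps [simp]:
  "carrier complex_field = UNIV"
  "x \<oplus>\<^bsub>complex_field\<^esub> y = x + y"
  "x \<otimes>\<^bsub>complex_field\<^esub> y = x * y"
  "\<zero>\<^bsub>complex_field\<^esub> = 0"
  "\<one>\<^bsub>complex_field\<^esub> = 1"
  by (simp_all add: ring_of_type_algebra_def)

theorem lie_algebra_presented_lie: "lie_algebra (presented_lie S R)"
proof -
  let ?L = "presented_lie S R"
  note simps = carrier_presented_lie presented_lie_ops presented_lie_zero lie_class_eq_iff
  have "abelian_group ?L"
  proof (rule abelian_groupI)
    fix x assume "x \<in> carrier ?L"
    then obtain s where s: "s \<in> lie_terms S" "x = lie_class S R s"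
      by (auto simp: carrier_presented_lie)
    have "lie_class S R (LScale (-1) s) \<oplus>\<^bsub>?L\<^esub> x = \<zero>\<^bsub>?L\<^esub>"
      using s by (simp add: simps lie_cong.add_inv)
    moreover have "lie_class S R (LScale (-1) s) \<in> carrier ?L"
      using s by simp
    ultimately show "\<exists>y\<in>carrier ?L. y \<oplus>\<^bsub>?L\<^esub> x = \<zero>\<^bsub>?L\<^esub>"
      by blast
  qed (auto simp: simps lie_cong.add_assoc lie_cong.add_comm lie_cong.add_zero del: equalityI)
  then have "module complex_field ?L"
    by (rule moduleI[OF cring_from_type_algebra])
      (auto simp: simps lie_cong.scale_one lie_cong.scale_add_left lie_cong.scale_add_right
          lie_cong.sym[OF lie_cong.scale_scale]
        del: equalityI)
  moreover have "lie_algebra_axioms ?L"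
    by unfold_locales
      (auto simp: simps lie_cong.bracket_add_left lie_cong.bracket_add_right
        lie_cong.bracket_scale_left lie_cong.bracket_scale_right lie_cong.bracket_self
        lie_cong.jacobi
        del: equalityI)
  ultimately show ?thesis
    by (rule lie_algebra.intro)
qed

primrec lie_eval :: "(complex, 'b) lie \<Rightarrow> ('x \<Rightarrow> 'b) \<Rightarrow> 'x lie_term \<Rightarrow> 'b"
  where
  "lie_eval L f (LGen x) = f x"
| "lie_eval L f LZero = \<zero>\<^bsub>L\<^esub>"
| "lie_eval L f (LAdd s t) = lie_eval L f s \<oplus>\<^bsub>L\<^esub> lie_eval L f t"
| "lie_eval L f (LScale c s) = c \<odot>\<^bsub>L\<^esub> lie_eval L f s"
| "lie_eval L f (LBracket s t) = lie_bracket L (lie_eval L f s) (lie_eval L f t)"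

lemma (in lie_algebra) lie_eval_closed:
  assumes "f \<in> UNIV \<rightarrow> carrier L"
  shows "lie_eval L f t \<in> carrier L"
  using assms by (induction t) (auto intro: bracket_closed smult_closed)

lemma (in lie_algebra) lie_eval_cong:
  assumes "lie_cong R s t" and f: "f \<in> UNIV \<rightarrow> carrier L"
    and R: "\<And>s t. (s, t) \<in> R \<Longrightarrow> lie_eval L f s = lie_eval L f t"
  shows "lie_eval L f s = lie_eval L f t"
  using assms(1)
proof induction
  case (add_inv s)
  have x: "lie_eval L f s \<in> carrier L"
    by (rule lie_eval_closed[OF f])
  have "lie_eval L f (LAdd (LScale (-1) s) s) =
      (- 1) \<odot> lie_eval L f s \<oplus> 1 \<odot> lie_eval L f s"
    using x smult_one[of "lie_eval L f s"] by simp
  also have "\<dots> = ((- 1) + 1) \<odot> lie_eval L f s"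
    using x smult_l_distr[of "- 1" 1 "lie_eval L f s"] by simp
  also have "\<dots> = \<zero>"
    using x smult_l_null by simp
  finally show ?case by simp
next
  case (add_assoc s t u)
  then show ?case using a_assoc lie_eval_closed[OF f] by simp
next
  case (scale_one s)
  then show ?case using smult_one lie_eval_closed[OF f] by simp
next
  case (scale_scale c d s)
  then show ?case using smult_assoc1[of c d] lie_eval_closed[OF f] by simp
next
  case (scale_add_left c d s)
  then show ?case using smult_l_distr[of c d] lie_eval_closed[OF f] by simp
next
  case (scale_add_right c s t)
  then show ?case using smult_r_distr[of c] lie_eval_closed[OF f] by simp
qed (simp_all add: R lie_eval_closed[OF f] a_comm bracket_add_left bracket_add_right
    bracket_smult_left bracket_smult_right bracket_self jacobi)

lemma lie_eval_restrict:
  assumes "\<And>x. x \<in> S \<Longrightarrow> f x = g x" "t \<in> lie_terms S"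
  shows "lie_eval L f t = lie_eval L g t"
  using assms(2) by (induction t) (simp_all add: assms(1))

theorem presented_lie_universal:
  assumes "lie_algebra L" and f: "f \<in> S \<rightarrow> carrier L" and "R \<subseteq> lie_terms S \<times> lie_terms S"
    and R: "\<And>s t. (s, t) \<in> R \<Longrightarrow> lie_eval L f s = lie_eval L f t"
  shows "\<exists>\<phi> \<in> lie_hom (presented_lie S R) L. \<forall>x\<in>S. \<phi> (lie_class S R (LGen x)) = f x"
    and "\<lbrakk>\<phi> \<in> lie_hom (presented_lie S R) L; \<psi> \<in> lie_hom (presented_lie S R) L;
      \<forall>x\<in>S. \<phi> (lie_class S R (LGen x)) = \<psi> (lie_class S R (LGen x));
      y \<in> carrier (presented_lie S R)\<rbrakk> \<Longrightarrow> \<phi> y = \<psi> y"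
proof -
  interpret lie_algebra L by fact
  let ?P = "presented_lie S R"
  define g where "g x = (if x \<in> S then f x else \<zero>\<^bsub>L\<^esub>)" for x
  have g: "g \<in> UNIV \<rightarrow> carrier L"
    using f by (auto simp: g_def)
  have eq: "lie_eval L f t = lie_eval L g t" if "t \<in> lie_terms S" for t
    using that by (rule lie_eval_restrict[rotated]) (simp add: g_def)
  have Rg: "lie_eval L g s = lie_eval L g t" if "(s, t) \<in> R" for s t
    using R[OF that] assms(3) that by (auto simp: eq)
  define \<phi> where "\<phi> x = lie_eval L g (SOME t. t \<in> lie_terms S \<and> x = lie_class S R t)" for x
  have \<phi>: "\<phi> (lie_class S R t) = lie_eval L g t" if "t \<in> lie_terms S" for t
  proof -
    let ?s = "SOME s. s \<in> lie_terms S \<and> lie_class S R t = lie_class S R s"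
    have "?s \<in> lie_terms S \<and> lie_class S R t = lie_class S R ?s"
      by (rule someI_ex) (use that in blast)
    then have "lie_cong R t ?s"
      using that lie_class_eq_iff by blast
    from lie_eval_cong[OF this g Rg] show ?thesis
      by (simp add: \<phi>_def)
  qed
  have "\<phi> \<in> lie_hom ?P L"
    by (auto simp: lie_hom_def carrier_presented_lie presented_lie_ops \<phi> lie_eval_closed[OF g])
  moreover have "\<forall>x\<in>S. \<phi> (lie_class S R (LGen x)) = f x"
    by (simp add: \<phi> g_def)
  ultimately show "\<exists>\<phi> \<in> lie_hom ?P L. \<forall>x\<in>S. \<phi> (lie_class S R (LGen x)) = f x"
    by blast
next
  interpret L: lie_algebra L by fact
  let ?P = "presented_lie S R"
  interpret P: lie_algebra ?P by (rule lie_algebra_presented_lie)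
  assume hom: "\<phi> \<in> lie_hom ?P L" "\<psi> \<in> lie_hom ?P L"
    and gen: "\<forall>x\<in>S. \<phi> (lie_class S R (LGen x)) = \<psi> (lie_class S R (LGen x))"
    and y: "y \<in> carrier ?P"
  have zero: "\<chi> (lie_class S R LZero) = \<zero>\<^bsub>L\<^esub>" if "\<chi> \<in> lie_hom ?P L" for \<chi>
  proof -
    have z: "0 \<odot>\<^bsub>?P\<^esub> lie_class S R LZero = lie_class S R LZero"
      using P.smult_r_null[of 0] by (simp add: presented_lie_zero)
    have "\<chi> (0 \<odot>\<^bsub>?P\<^esub> lie_class S R LZero) = 0 \<odot>\<^bsub>L\<^esub> \<chi> (lie_class S R LZero)"
      using that by (simp add: lie_hom_def)
    moreover have "\<chi> (lie_class S R LZero) \<in> carrier L"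
      using that by (auto simp: lie_hom_def)
    ultimately show ?thesis
      using L.smult_l_null z by simp
  qed
  have "\<phi> (lie_class S R t) = \<psi> (lie_class S R t)" if "t \<in> lie_terms S" for t
    using that
  proof (induction t)
    case (LGen x)
    then show ?case using gen by simp
  next
    case LZero
    show ?case using zero[OF hom(1)] zero[OF hom(2)] by simp
  next
    case (LAdd s t)
    then have hom_ladd: "\<chi> (lie_class S R (LAdd s t)) = \<chi> (lie_class S R s) \<oplus>\<^bsub>L\<^esub> \<chi> (lie_class S R t)"
      if "\<chi> \<in> lie_hom ?P L" for \<chi>
      using that by (simp add: lie_hom_def flip: presented_lie_ops)
    from LAdd hom_ladd[OF hom(1)] hom_ladd[OF hom(2)] show ?case by simp
  next
    case (LScale c s)
    then have hom_lscale: "\<chi> (lie_class S R (LScale c s)) = c \<odot>\<^bsub>L\<^esub> \<chi> (lie_class S R s)"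
      if "\<chi> \<in> lie_hom ?P L" for \<chi>
      using that by (simp add: lie_hom_def flip: presented_lie_ops(2)[where t = s])
    from LScale hom_lscale[OF hom(1)] hom_lscale[OF hom(2)] show ?case by simp
  next
    case (LBracket s t)
    then have hom_lbracket: "\<chi> (lie_class S R (LBracket s t)) =
        lie_bracket L (\<chi> (lie_class S R s)) (\<chi> (lie_class S R t))"
      if "\<chi> \<in> lie_hom ?P L" for \<chi>
      using that by (simp add: lie_hom_def flip: presented_lie_ops)
    from LBracket hom_lbracket[OF hom(1)] hom_lbracket[OF hom(2)] show ?case by simp
  qed
  with y show "\<phi> y = \<psi> y"
    by (auto simp: carrier_presented_lie)
qed


section \<open>Borcherds algebras\<close>

definition symmetrized_borcherds_cartan :: "'i set \<Rightarrow> ('i \<Rightarrow> 'i \<Rightarrow> real) \<Rightarrow> bool"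
  where "symmetrized_borcherds_cartan I A \<longleftrightarrow>
    (\<forall>i\<in>I. \<forall>j\<in>I. A i j = A j i) \<and>
    (\<forall>i\<in>I. \<forall>j\<in>I. i \<noteq> j \<longrightarrow> A i j \<le> 0) \<and>
    (\<forall>i\<in>I. A i i > 0 \<longrightarrow> (\<forall>j\<in>I. 2 * A i j / A i i \<in> \<int>))"

datatype 'i borcherds_gen = Gen_e 'i | Gen_f 'i | Gen_h 'i

definition borcherds_gens :: "'i set \<Rightarrow> 'i borcherds_gen set"
  where "borcherds_gens I = Gen_e ` I \<union> Gen_f ` I \<union> Gen_h ` I"

text \<open>
  For a symmetrized Borcherds Cartan matrix, \<open>1 - 2 * A i j / A i i\<close> is a positive integer
  whenever \<open>i \<noteq> j\<close> and \<open>A i i > 0\<close>, so \<open>serre_exponent\<close> only changes its type.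
\<close>

definition serre_exponent :: "('i \<Rightarrow> 'i \<Rightarrow> real) \<Rightarrow> 'i \<Rightarrow> 'i \<Rightarrow> nat"
  where "serre_exponent A i j = nat \<lfloor>1 - 2 * A i j / A i i\<rfloor>"

definition borcherds_relations ::
    "'i set \<Rightarrow> ('i \<Rightarrow> 'i \<Rightarrow> real) \<Rightarrow> ('i borcherds_gen lie_term \<times> 'i borcherds_gen lie_term) set"
  where "borcherds_relations I A =
    (let e = \<lambda>i. LGen (Gen_e i); f = \<lambda>i. LGen (Gen_f i); h = \<lambda>i. LGen (Gen_h i) in
      {(LBracket (h i) (h j), LZero) | i j. i \<in> I \<and> j \<in> I} \<union>
      {(LBracket (h i) (e j), LScale (complex_of_real (A i j)) (e j)) | i j. i \<in> I \<and> j \<in> I} \<union>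
      {(LBracket (h i) (f j), LScale (- complex_of_real (A i j)) (f j)) | i j. i \<in> I \<and> j \<in> I} \<union>
      {(LBracket (e i) (f j), if i = j then h i else LZero) | i j. i \<in> I \<and> j \<in> I} \<union>
      {((LBracket (e i) ^^ serre_exponent A i j) (e j), LZero) | i j.
        i \<in> I \<and> j \<in> I \<and> i \<noteq> j \<and> A i i > 0} \<union>
      {((LBracket (f i) ^^ serre_exponent A i j) (f j), LZero) | i j.
        i \<in> I \<and> j \<in> I \<and> i \<noteq> j \<and> A i i > 0} \<union>
      {(LBracket (e i) (e j), LZero) | i j. i \<in> I \<and> j \<in> I \<and> A i j = 0} \<union>
      {(LBracket (f i) (f j), LZero) | i j. i \<in> I \<and> j \<in> I \<and> A i j = 0})"

text \<open>
  The matrix is only used at indices in \<open>I\<close>, so for \<open>J \<subseteq> I\<close> the Borcherds algebra of the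
  submatrix indexed by \<open>J\<close> is \<open>borcherds J A\<close>.
\<close>

definition borcherds ::
    "'i set \<Rightarrow> ('i \<Rightarrow> 'i \<Rightarrow> real) \<Rightarrow> (complex, 'i borcherds_gen lie_term set) lie"
  where "borcherds I A = presented_lie (borcherds_gens I) (borcherds_relations I A)"

definition borcherds_e ::
    "'i set \<Rightarrow> ('i \<Rightarrow> 'i \<Rightarrow> real) \<Rightarrow> 'i \<Rightarrow> 'i borcherds_gen lie_term set"
  where "borcherds_e I A i = lie_class (borcherds_gens I) (borcherds_relations I A) (LGen (Gen_e i))"

definition borcherds_f ::
    "'i set \<Rightarrow> ('i \<Rightarrow> 'i \<Rightarrow> real) \<Rightarrow> 'i \<Rightarrow> 'i borcherds_gen lie_term set"
  where "borcherds_f I A i = lie_class (borcherds_gens I) (borcherds_relations I A) (LGen (Gen_f i))"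

definition borcherds_h ::
    "'i set \<Rightarrow> ('i \<Rightarrow> 'i \<Rightarrow> real) \<Rightarrow> 'i \<Rightarrow> 'i borcherds_gen lie_term set"
  where "borcherds_h I A i = lie_class (borcherds_gens I) (borcherds_relations I A) (LGen (Gen_h i))"

definition borcherds_cartan ::
    "'i set \<Rightarrow> ('i \<Rightarrow> 'i \<Rightarrow> real) \<Rightarrow> 'i borcherds_gen lie_term set set"
  where "borcherds_cartan I A = lie_generate (borcherds I A) (borcherds_h I A ` I)"

definition borcherds_sub ::
    "'i set \<Rightarrow> ('i \<Rightarrow> 'i \<Rightarrow> real) \<Rightarrow> 'i set \<Rightarrow> 'i borcherds_gen lie_term set set"
  where "borcherds_sub I A J = lie_generate (borcherds I A)
    (borcherds_e I A ` J \<union> borcherds_f I A ` J \<union> borcherds_h I A ` J)"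

text \<open>
  The elements \<open>ad(x j\<^sub>1)^l\<^sub>1 \<dots> ad(x j\<^sub>n)^l\<^sub>n (x i)\<close> with \<open>n \<ge> 0\<close>, \<open>j\<^sub>1 < \<dots> < j\<^sub>n\<close> in \<open>J\<close> with
  respect to the (reflexive) order \<open>r\<close>, all \<open>l\<^sub>k > 0\<close>, and \<open>i \<in> K\<close>; the word is encoded as the
  list of the pairs \<open>(j\<^sub>k, l\<^sub>k)\<close>.
\<close>

definition ad_monomials ::
    "(complex, 'b) lie \<Rightarrow> ('i \<Rightarrow> 'b) \<Rightarrow> 'i rel \<Rightarrow> 'i set \<Rightarrow> 'i set \<Rightarrow> 'b set"
  where "ad_monomials L x r J K =
    {foldr (\<lambda>(j, l). lie_bracket L (x j) ^^ l) w (x i) | w i.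
      set (map fst w) \<subseteq> J \<and>
      sorted_wrt (\<lambda>j k. (j, k) \<in> r \<and> j \<noteq> k) (map fst w) \<and>
      (\<forall>(j, l) \<in> set w. 0 < l) \<and>
      i \<in> K}"

end

theory Submission
  imports Defs "HOL-Library.Function_Algebras" "HOL-Library.Multiset"
begin

text \<open>
  Let \<open>g\<close> be the Borcherds algebra. Since no diagonal entry is positive and \<open>a\<^sub>i\<^sub>j = 0\<close> holds exactly
  for \<open>i, j \<in> J\<close>, its relations say that \<open>h\<close> acts diagonally, \<open>[e\<^sub>i, f\<^sub>j] = \<delta>\<^sub>i\<^sub>j h\<^sub>i\<close>, and the
  \<open>e\<^sub>j\<close> (respectively \<open>f\<^sub>j\<close>) with \<open>j \<in> J\<close> commute with each other.

  \<^emph>\<open>Spanning.\<close> Put \<open>l = g\<^sub>J + h\<close> and let \<open>u\<^sup>-\<close> be generated by the words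
  \<open>ad f\<^sub>j\<^sub>1 \<dots> ad f\<^sub>j\<^sub>n f\<^sub>i\<close> with \<open>j\<^sub>k \<in> J\<close> and \<open>i \<notin> J\<close>; as the \<open>f\<^sub>j\<close> commute, these are the ordered
  monomials of the theorem. Bracketing a word with \<open>f\<^sub>j\<close>, \<open>h\<^sub>l\<close> or \<open>e\<^sub>j\<close> (\<open>j \<in> J\<close>) gives a combination
  of words, and bracketing it with \<open>e\<^sub>i\<close> (\<open>i \<notin> J\<close>) gives an element of \<open>l\<close>. Hence
  \<open>u\<^sup>- + l + u\<^sup>+\<close> is stable under all generators and contains them, so it is everything
  (\<open>borcherds_triple.whole_eq\<close>). The exchange of \<open>e\<close> and \<open>f\<close> (with \<open>h \<mapsto> -h\<close>) preserves the
  relations, which halves the work.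

  \<^emph>\<open>Independence.\<close> A Verma type module is written down explicitly. Let \<open>T\<close> be the free associative
  algebra on letters \<open>x\<^sub>M\<^sub>,\<^sub>k\<close>, with \<open>M\<close> a finite multiset; the letter \<open>x\<^sub>M\<^sub>,\<^sub>i\<close>
  stands for the word \<open>ad(f)\<^sup>M f\<^sub>i\<close>, and there is one more index \<open>k = None\<close>, whose weight is
  governed by a free parameter \<open>lam\<close>.
  The elements \<open>h\<^sub>i\<close>, and \<open>f\<^sub>j\<close>, \<open>e\<^sub>j\<close> for \<open>j \<in> J\<close>, act on \<open>T\<close> by derivations (scaling,
  raising and lowering \<open>M\<close>); for \<open>i \<notin> J\<close>, \<open>f\<^sub>i\<close> acts by left multiplication with \<open>x\<^sub>0\<^sub>,\<^sub>i\<close> and \<open>e\<^sub>i\<close> kills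
  \<open>1\<close> and satisfies \<open>e\<^sub>i(x w) = [e\<^sub>i, x] w + x e\<^sub>i(w)\<close>. A word of \<open>u\<^sup>-\<close> then acts as
  left multiplication by its letter, while \<open>l\<close> and \<open>u\<^sup>+\<close> annihilate \<open>1\<close>. So everything about
  \<open>u\<^sup>-\<close> can be read off from the value at \<open>1\<close>, provided that the free Lie algebra embeds into the free
  associative algebra. All operators are transposed, that is, they act on functions of words with
  values in an arbitrary vector space, which turns left multiplication into a mere shift.

  \<^emph>\<open>The embedding.\<close> Over a field of characteristic zero it has a short proof that avoids the
  theorem of Poincare, Birkhoff and Witt: the map \<open>D(x\<^sub>1 \<dots> x\<^sub>n) = [x\<^sub>1, [x\<^sub>2, \<dots> x\<^sub>n]]\<close>, extended
  linearly to \<open>T\<close>, restricts on Lie elements to the derivation which multiplies by the degree, and that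
  derivation is injective (\<open>degree_derivation_injective\<close>). Using \<open>D\<close> as the function of words on which
  \<open>g\<close> acts gives freeness of \<open>u\<^sup>\<plusminus>\<close> and uniqueness of the decomposition.

  Finally the Borcherds algebra of \<open>J\<close> is spanned by its generators, and the action on
  letters with index \<open>None\<close>, for suitable \<open>lam\<close>, provides linear functionals dual to their images
  in \<open>g\<close>; so it embeds into \<open>g\<close>.
\<close>

section \<open>Complex vector spaces and their endomorphisms\<close>

class complex_vector = ab_group_add +
  fixes scaleC :: "complex \<Rightarrow> 'a \<Rightarrow> 'a" (infixr "*\<^sub>C" 75)
  assumes scaleC_add_right: "c *\<^sub>C (x + y) = c *\<^sub>C x + c *\<^sub>C y"
    and scaleC_add_left: "(c + d) *\<^sub>C x = c *\<^sub>C x + d *\<^sub>C x"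
    and scaleC_scaleC: "c *\<^sub>C d *\<^sub>C x = (c * d) *\<^sub>C x"
    and scaleC_one: "1 *\<^sub>C x = x"

interpretation complex_vector: vector_space scaleC
  by standard (simp_all add: scaleC_add_right scaleC_add_left scaleC_scaleC scaleC_one)

lemmas scaleC_simps = complex_vector.scale_right_distrib complex_vector.scale_left_distrib
  complex_vector.scale_right_diff_distrib complex_vector.scale_left_diff_distrib

instantiation complex :: complex_vector
begin
definition scaleC_complex :: "complex \<Rightarrow> complex \<Rightarrow> complex" where "c *\<^sub>C x = c * x"
instance by standard (simp_all add: scaleC_complex_def algebra_simps)
end

instantiation "fun" :: (type, complex_vector) complex_vector
begin
definition scaleC_fun :: "complex \<Rightarrow> ('a \<Rightarrow> 'b) \<Rightarrow> 'a \<Rightarrow> 'b"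
  where "c *\<^sub>C f = (\<lambda>x. c *\<^sub>C f x)"
instance
  by standard (simp_all add: fun_eq_iff scaleC_fun_def scaleC_simps)
end

lemma scaleC_fun_apply [simp]: "(c *\<^sub>C f) x = c *\<^sub>C f x"
  by (simp add: scaleC_fun_def)

definition complex_linear :: "('v::complex_vector \<Rightarrow> 'w::complex_vector) \<Rightarrow> bool"
  where "complex_linear P \<longleftrightarrow>
    (\<forall>x y. P (x + y) = P x + P y) \<and> (\<forall>c x. P (c *\<^sub>C x) = c *\<^sub>C P x)"

lemma complex_linearD:
  assumes "complex_linear P"
  shows "P (x + y) = P x + P y" "P (c *\<^sub>C x) = c *\<^sub>C P x" "P 0 = 0" "P (x - y) = P x - P y"
    "P (- x) = - P x"
proof -
  show a: "P (x + y) = P x + P y" for x y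
    using assms by (simp add: complex_linear_def)
  show s: "P (c *\<^sub>C x) = c *\<^sub>C P x" for c x
    using assms by (simp add: complex_linear_def)
  show z: "P 0 = 0" using a[of 0 0] by simp
  show "P (x - y) = P x - P y" using a[of "x - y" y] by (simp add: algebra_simps)
  show "P (- x) = - P x" using a[of "- x" x] z by (simp add: eq_neg_iff_add_eq_0)
qed

text \<open>
  The bracket is \<open>QP - PQ\<close>: the operators below are transposes of operators on a space of words,
  and transposition reverses products.
\<close>

definition opposite_gl :: "(complex, 'v::complex_vector \<Rightarrow> 'v) lie"
  where "opposite_gl =
    \<lparr>carrier = Collect complex_linear, monoid.mult = undefined, one = undefined,
     ring.zero = 0, add = (+), module.smult = scaleC,
     lie_bracket = (\<lambda>P Q x. Q (P x) - P (Q x))\<rparr>"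

lemma opposite_gl_simps [simp]:
  "P \<in> carrier opposite_gl \<longleftrightarrow> complex_linear P"
  "\<zero>\<^bsub>opposite_gl\<^esub> = 0"
  "P \<oplus>\<^bsub>opposite_gl\<^esub> Q = P + Q"
  "c \<odot>\<^bsub>opposite_gl\<^esub> P = c *\<^sub>C P"
  "lie_bracket opposite_gl P Q = (\<lambda>x. Q (P x) - P (Q x))"
  by (simp_all add: opposite_gl_def)

lemma lie_algebra_opposite_gl: "lie_algebra opposite_gl"
proof -
  have "abelian_group (opposite_gl :: (complex, 'a \<Rightarrow> 'a) lie)"
  proof (rule abelian_groupI)
    fix P :: "'a \<Rightarrow> 'a" assume "P \<in> carrier opposite_gl"
    then have "(- 1) *\<^sub>C P \<in> carrier opposite_gl" "(- 1) *\<^sub>C P + P = 0"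
      by (auto simp: complex_linear_def scaleC_simps fun_eq_iff)
    then show "\<exists>Q\<in>carrier (opposite_gl :: (complex, 'a \<Rightarrow> 'a) lie).
        Q \<oplus>\<^bsub>opposite_gl\<^esub> P = \<zero>\<^bsub>opposite_gl\<^esub>"
      by (metis opposite_gl_simps(2,3))
  qed (auto simp: complex_linear_def scaleC_simps add_ac)
  then have "module complex_field (opposite_gl :: (complex, 'a \<Rightarrow> 'a) lie)"
    by (rule moduleI[OF cring_from_type_algebra])
      (auto simp: complex_linear_def scaleC_simps mult.commute)
  moreover have "lie_algebra_axioms (opposite_gl :: (complex, 'a \<Rightarrow> 'a) lie)"
  proof
    fix P Q R :: "'a \<Rightarrow> 'a"
    assume "P \<in> carrier opposite_gl" "Q \<in> carrier opposite_gl" "R \<in> carrier opposite_gl"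
    then have lin: "complex_linear P" "complex_linear Q" "complex_linear R"
      by simp_all
    note lin = complex_linearD[OF lin(1)] complex_linearD[OF lin(2)] complex_linearD[OF lin(3)]
    show "lie_bracket opposite_gl P (lie_bracket opposite_gl Q R) \<oplus>\<^bsub>opposite_gl\<^esub>
        (lie_bracket opposite_gl Q (lie_bracket opposite_gl R P) \<oplus>\<^bsub>opposite_gl\<^esub>
         lie_bracket opposite_gl R (lie_bracket opposite_gl P Q)) = \<zero>\<^bsub>opposite_gl\<^esub>"
      by (simp add: fun_eq_iff lin)
  qed (auto simp: complex_linear_def scaleC_simps fun_eq_iff)
  ultimately show ?thesis by (rule lie_algebra.intro)
qed

section \<open>The free Lie algebra as a vector space\<close>

text \<open>
  The free Lie algebra on all elements of \<open>'x\<close>, as a type, so that functions with values in it form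
  an instance of \<open>complex_vector\<close>.
\<close>

quotient_type 'x free_lie_type = "'x lie_term" / "lie_cong {}"
  by (auto intro!: equivpI reflpI sympI transpI intro: lie_cong.refl lie_cong.sym lie_cong.trans)

lift_definition free_scale :: "complex \<Rightarrow> 'x free_lie_type \<Rightarrow> 'x free_lie_type"
  is LScale by (rule lie_cong.cong_scale)

instantiation free_lie_type :: (type) complex_vector
begin

lift_definition zero_free_lie_type :: "'a free_lie_type" is LZero .
lift_definition plus_free_lie_type :: "'a free_lie_type \<Rightarrow> 'a free_lie_type \<Rightarrow> 'a free_lie_type"
  is LAdd by (rule lie_cong.cong_add)
definition scaleC_free_lie_type :: "complex \<Rightarrow> 'a free_lie_type \<Rightarrow> 'a free_lie_type"
  where "scaleC_free_lie_type = free_scale"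
definition uminus_free_lie_type :: "'a free_lie_type \<Rightarrow> 'a free_lie_type"
  where "uminus_free_lie_type = free_scale (- 1)"
definition minus_free_lie_type :: "'a free_lie_type \<Rightarrow> 'a free_lie_type \<Rightarrow> 'a free_lie_type"
  where "minus_free_lie_type x y = x + (- y)"

instance
proof
  fix a b c :: "'a free_lie_type" and z w :: complex
  show "a + b + c = a + (b + c)" by transfer (rule lie_cong.add_assoc)
  show "a + b = b + a" by transfer (rule lie_cong.add_comm)
  show "0 + a = a" by transfer (rule lie_cong.add_zero)
  show "- a + a = 0" unfolding uminus_free_lie_type_def by transfer (rule lie_cong.add_inv)
  show "a - b = a + - b" by (rule minus_free_lie_type_def)
  show "z *\<^sub>C (a + b) = z *\<^sub>C a + z *\<^sub>C b" unfolding scaleC_free_lie_type_def by transfer (rule lie_cong.scale_add_right)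
  show "(z + w) *\<^sub>C a = z *\<^sub>C a + w *\<^sub>C a" unfolding scaleC_free_lie_type_def by transfer (rule lie_cong.scale_add_left)
  show "z *\<^sub>C w *\<^sub>C a = (z * w) *\<^sub>C a" unfolding scaleC_free_lie_type_def by transfer (rule lie_cong.scale_scale)
  show "1 *\<^sub>C a = a" unfolding scaleC_free_lie_type_def by transfer (rule lie_cong.scale_one)
qed

end

lift_definition free_gen :: "'x \<Rightarrow> 'x free_lie_type" is LGen .
lift_definition free_bracket :: "'x free_lie_type \<Rightarrow> 'x free_lie_type \<Rightarrow> 'x free_lie_type"
  is LBracket by (rule lie_cong.cong_bracket)

lemma free_bracket_linear:
  "free_bracket (a + b) c = free_bracket a c + free_bracket b c"
  "free_bracket c (a + b) = free_bracket c a + free_bracket c b"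
  "free_bracket (z *\<^sub>C a) c = z *\<^sub>C free_bracket a c"
  "free_bracket c (z *\<^sub>C a) = z *\<^sub>C free_bracket c a"
  unfolding scaleC_free_lie_type_def
  by (transfer, rule lie_cong.bracket_add_left lie_cong.bracket_add_right
    lie_cong.bracket_scale_left lie_cong.bracket_scale_right)+

lemma complex_linear_free_bracket:
  "complex_linear (free_bracket a)" "complex_linear (\<lambda>a. free_bracket a b)"
  by (simp_all add: complex_linear_def free_bracket_linear)

lemmas free_bracket_simps = free_bracket_linear
  complex_linearD(3-)[OF complex_linear_free_bracket(1)]
  complex_linearD(3-)[OF complex_linear_free_bracket(2)]

lemma free_bracket_self: "free_bracket a a = 0"
  by transfer (rule lie_cong.bracket_self)

lemma free_bracket_anticomm: "free_bracket a b = - free_bracket b a"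
proof -
  have "free_bracket a b + free_bracket b a = 0"
    using free_bracket_self[of "a + b"]
    unfolding free_bracket_linear by (simp only: free_bracket_self add_0_left add_0_right add.commute)
  then show ?thesis
    by (simp only: eq_neg_iff_add_eq_0)
qed

lemma free_bracket_jacobi:
  "free_bracket (free_bracket a b) c =
    free_bracket a (free_bracket b c) - free_bracket b (free_bracket a c)"
proof -
  have j: "free_bracket a (free_bracket b c) +
    (free_bracket b (free_bracket c a) + free_bracket c (free_bracket a b)) = 0"
    by transfer (rule lie_cong.jacobi)
  have "free_bracket b (free_bracket c a) = - free_bracket b (free_bracket a c)"
    by (subst free_bracket_anticomm[of c a]) (simp add: free_bracket_simps)
  moreover have "free_bracket c (free_bracket a b) = - free_bracket (free_bracket a b) c"
    by (rule free_bracket_anticomm)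
  ultimately show ?thesis
    using j by (simp add: algebra_simps)
qed

section \<open>Dynkin's map and the degree derivation\<close>

definition shift :: "'x \<Rightarrow> ('x list \<Rightarrow> 'v) \<Rightarrow> 'x list \<Rightarrow> 'v"
  where "shift x \<phi> = (\<lambda>w. \<phi> (x # w))"

lemma shift_apply [simp]: "shift x \<phi> w = \<phi> (x # w)"
  by (simp add: shift_def)

lemma complex_linear_shift [simp]: "complex_linear (shift x)"
  by (simp add: complex_linear_def fun_eq_iff)

text \<open>
  The transpose of left multiplication by (the image in the free associative algebra of) a Lie
  expression: \<open>left_mult t \<phi> w\<close> is the value at \<open>t w\<close> of the linear extension of \<open>\<phi>\<close>.
\<close>

definition left_mult :: "'x lie_term \<Rightarrow> ('x list \<Rightarrow> 'v::complex_vector) \<Rightarrow> 'x list \<Rightarrow> 'v"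
  where "left_mult = lie_eval opposite_gl shift"

lemma left_mult_simps [simp]:
  "left_mult (LGen x) = shift x"
  "left_mult LZero = 0"
  "left_mult (LAdd s t) = left_mult s + left_mult t"
  "left_mult (LScale c s) = c *\<^sub>C left_mult s"
  "left_mult (LBracket s t) =
    (\<lambda>\<phi>. left_mult t (left_mult s \<phi>) - left_mult s (left_mult t \<phi>))"
  by (simp_all add: left_mult_def)

lemma left_mult_cong: "lie_cong {} s t \<Longrightarrow> left_mult s = left_mult t"
  unfolding left_mult_def by (rule lie_algebra.lie_eval_cong[OF lie_algebra_opposite_gl]) auto

text \<open>
  A Lie expression has no constant term, so \<open>t w\<close> only involves nonempty words.
\<close>

lemma left_mult_local:
  assumes "\<And>w. w \<noteq> [] \<Longrightarrow> \<phi> w = \<psi> w"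
  shows "left_mult t \<phi> = left_mult t \<psi>"
  using assms
proof (induction t arbitrary: \<phi> \<psi>)
  case (LGen x)
  show ?case by (auto simp: LGen)
next
  case (LAdd s t)
  from LAdd.IH(1,2)[OF LAdd.prems] show ?case by simp
next
  case (LScale c t)
  from LScale.IH[OF LScale.prems] show ?case by simp
next
  case (LBracket s t)
  from LBracket.IH(1,2)[OF LBracket.prems] show ?case by simp
qed simp

text \<open>
  Left multiplication on words commutes with linear maps on values.
\<close>

lemma left_mult_compose:
  assumes "complex_linear g"
  shows "left_mult t (\<lambda>w. g (\<phi> w)) w = g (left_mult t \<phi> w)"
proof (induction t arbitrary: \<phi> w)
  case (LBracket s t)
  have "left_mult u (\<lambda>w. g (\<psi> w)) = (\<lambda>w. g (left_mult u \<psi> w))" if "u = s \<or> u = t" for u \<psi>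
    using LBracket that by auto
  then show ?case
    by (simp add: complex_linearD[OF assms])
qed (simp_all add: complex_linearD[OF assms])

text \<open>
  Right-normed bracketing of words, the map of Dynkin, Specht and Wever.
\<close>

fun dynkin :: "'x list \<Rightarrow> 'x free_lie_type"
  where
  "dynkin [] = 0"
| "dynkin [x] = free_gen x"
| "dynkin (x # y # w) = free_bracket (free_gen x) (dynkin (y # w))"

lemma dynkin_Cons: "w \<noteq> [] \<Longrightarrow> dynkin (x # w) = free_bracket (free_gen x) (dynkin w)"
  by (cases w) auto

lemma abs_free_lie_type_simps:
  "abs_free_lie_type (LGen x) = free_gen x"
  "abs_free_lie_type LZero = 0"
  "abs_free_lie_type (LAdd s t) = abs_free_lie_type s + abs_free_lie_type t"
  "abs_free_lie_type (LScale c s) = c *\<^sub>C abs_free_lie_type s"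
  "abs_free_lie_type (LBracket s t) = free_bracket (abs_free_lie_type s) (abs_free_lie_type t)"
  by (simp_all add: free_gen.abs_eq zero_free_lie_type.abs_eq plus_free_lie_type.abs_eq
    scaleC_free_lie_type_def free_scale.abs_eq free_bracket.abs_eq)

text \<open>
  On nonempty words left multiplication by a letter corresponds to the adjoint action by
  definition; both sides define Lie homomorphisms in \<open>t\<close>, so they agree on all Lie expressions.
\<close>

lemma left_mult_dynkin:
  "w \<noteq> [] \<Longrightarrow> left_mult t dynkin w = free_bracket (abs_free_lie_type t) (dynkin w)"
proof (induction t arbitrary: w)
  case (LBracket s t)
  have "left_mult u (left_mult v dynkin) w =
      free_bracket (abs_free_lie_type v) (free_bracket (abs_free_lie_type u) (dynkin w))"
    if "u = s \<and> v = t \<or> u = t \<and> v = s" for u v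
  proof -
    have "left_mult u (left_mult v dynkin) =
        left_mult u (\<lambda>w. free_bracket (abs_free_lie_type v) (dynkin w))"
      by (rule left_mult_local) (use LBracket.IH that in blast)
    then show ?thesis
      using LBracket that by (auto simp: left_mult_compose complex_linear_free_bracket)
  qed
  then show ?case
    by (simp add: abs_free_lie_type_simps free_bracket_jacobi)
qed (simp_all add: abs_free_lie_type_simps free_bracket_simps dynkin_Cons)

text \<open>
  The value of Dynkin's map on the associative image of a Lie element. It is a
  derivation that fixes the generators, hence multiplies an element of degree \<open>n\<close> by \<open>n\<close>.
\<close>

definition degree_derivation :: "'x free_lie_type \<Rightarrow> 'x free_lie_type"
  where "degree_derivation a = left_mult (rep_free_lie_type a) dynkin []"

lemma degree_derivation_abs: "degree_derivation (abs_free_lie_type t) = left_mult t dynkin []"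
proof -
  have "lie_cong {} (rep_free_lie_type (abs_free_lie_type t)) t"
    using Quotient3_rep_abs[OF Quotient3_free_lie_type] lie_cong.refl by blast
  then have "left_mult (rep_free_lie_type (abs_free_lie_type t)) dynkin = left_mult t dynkin"
    by (simp only: left_mult_cong)
  then show ?thesis
    by (simp only: degree_derivation_def)
qed

lemma left_mult_bracket_dynkin_Nil:
  "left_mult s (left_mult t dynkin) [] = free_bracket (abs_free_lie_type t) (left_mult s dynkin [])"
proof -
  have "left_mult s (left_mult t dynkin) =
      left_mult s (\<lambda>w. free_bracket (abs_free_lie_type t) (dynkin w))"
    by (rule left_mult_local) (rule left_mult_dynkin)
  then show ?thesis
    by (simp add: left_mult_compose complex_linear_free_bracket)
qed

lemma free_lie_type_cases [case_names abs]:
  obtains t where "a = abs_free_lie_type t"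
  by (metis Quotient3_abs_rep[OF Quotient3_free_lie_type])

lemma degree_derivation_simps:
  "degree_derivation (free_gen x) = free_gen x"
  "degree_derivation (a + b) = degree_derivation a + degree_derivation b"
  "degree_derivation (c *\<^sub>C a) = c *\<^sub>C degree_derivation a"
  "degree_derivation (free_bracket a b) =
    free_bracket (degree_derivation a) b + free_bracket a (degree_derivation b)"
proof -
  show "degree_derivation (free_gen x) = free_gen x"
    using degree_derivation_abs[of "LGen x"] by (simp add: abs_free_lie_type_simps)
  obtain s t where st: "a = abs_free_lie_type s" "b = abs_free_lie_type t"
    by (metis free_lie_type_cases)
  show "degree_derivation (a + b) = degree_derivation a + degree_derivation b"
    using degree_derivation_abs[of "LAdd s t"] by (simp add: abs_free_lie_type_simps st degree_derivation_abs)
  show "degree_derivation (c *\<^sub>C a) = c *\<^sub>C degree_derivation a"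
    using degree_derivation_abs[of "LScale c s"] by (simp add: abs_free_lie_type_simps st degree_derivation_abs)
  show "degree_derivation (free_bracket a b) =
    free_bracket (degree_derivation a) b + free_bracket a (degree_derivation b)"
    using degree_derivation_abs[of "LBracket s t"] free_bracket_anticomm[of "degree_derivation a" b]
    by (simp add: abs_free_lie_type_simps st degree_derivation_abs left_mult_bracket_dynkin_Nil)
qed

lemma complex_linear_degree_derivation: "complex_linear degree_derivation"
  by (simp add: complex_linear_def degree_derivation_simps)

lemma span_homogeneous:
  "a \<in> complex_vector.span {b. \<exists>n>0. degree_derivation b = of_nat n *\<^sub>C b}"
proof -
  let ?H = "{b::'a free_lie_type. \<exists>n>0. degree_derivation b = of_nat n *\<^sub>C b}"
  have bracket: "free_bracket a b \<in> complex_vector.span ?H"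
    if "a \<in> complex_vector.span ?H" "b \<in> complex_vector.span ?H" for a b
    using that(1)
  proof (induction rule: complex_vector.span_induct_alt)
    case base
    then show ?case by (simp add: free_bracket_simps complex_vector.span_zero)
  next
    case (step c x y)
    have "free_bracket x b \<in> complex_vector.span ?H"
      using that(2)
    proof (induction rule: complex_vector.span_induct_alt)
      case base
      then show ?case by (simp add: free_bracket_simps complex_vector.span_zero)
    next
      case (step d x' y')
      from \<open>x \<in> ?H\<close> obtain n where n: "n > 0" "degree_derivation x = of_nat n *\<^sub>C x" by auto
      from \<open>x' \<in> ?H\<close> obtain m where m: "m > 0" "degree_derivation x' = of_nat m *\<^sub>C x'" by auto
      have "degree_derivation (free_bracket x x') = of_nat (n + m) *\<^sub>C free_bracket x x'"
        by (simp add: degree_derivation_simps n m free_bracket_simps scaleC_simps)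
      with n have "free_bracket x x' \<in> ?H" by (auto intro!: exI[of _ "n + m"] simp del: of_nat_add)
      then show ?case
        unfolding free_bracket_simps
        by (intro complex_vector.span_add complex_vector.span_scale step.IH)
          (rule complex_vector.span_base)
    qed
    then show ?case
      unfolding free_bracket_simps
      by (intro complex_vector.span_add complex_vector.span_scale step.IH)
  qed
  obtain t where "a = abs_free_lie_type t" by (rule free_lie_type_cases)
  moreover have "abs_free_lie_type t \<in> complex_vector.span ?H"
  proof (induction t)
    case (LGen x)
    have "free_gen x \<in> ?H" by (auto intro!: exI[of _ 1] simp: degree_derivation_simps)
    then show ?case by (simp add: abs_free_lie_type_simps complex_vector.span_base)
  qed (simp_all add: abs_free_lie_type_simps complex_vector.span_zero complex_vector.span_add
    complex_vector.span_scale bracket)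
  ultimately show ?thesis by simp
qed

text \<open>
  Every element is a sum of eigenvectors with positive integer eigenvalues, so it is annihilated by
  \<open>(E - 1) \<dots> (E - N)\<close> for large \<open>N\<close>, where \<open>E\<close> is the derivation. On the kernel of \<open>E\<close> this
  product is the nonzero scalar \<open>(-1) \<dots> (-N)\<close>.
\<close>

lemma degree_derivation_injective:
  assumes "degree_derivation a = 0"
  shows "a = 0"
proof -
  define q :: "nat \<Rightarrow> 'a free_lie_type \<Rightarrow> 'a free_lie_type"
    where "q = rec_nat id (\<lambda>n p b. degree_derivation (p b) - of_nat (Suc n) *\<^sub>C p b)"
  have q_simps: "q 0 b = b" "q (Suc n) b = degree_derivation (q n b) - of_nat (Suc n) *\<^sub>C q n b" for n b
    by (simp_all add: q_def)
  note lin = complex_linearD[OF complex_linear_degree_derivation]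
  have eigen: "q n b = (\<Prod>k=1..n. (m - of_nat k)) *\<^sub>C b" if "degree_derivation b = m *\<^sub>C b" for m n b
  proof (induction n)
    case (Suc n)
    let ?P = "\<Prod>k=1..n. (m - of_nat k)"
    have "q (Suc n) b = ?P *\<^sub>C m *\<^sub>C b - of_nat (Suc n) *\<^sub>C ?P *\<^sub>C b"
      by (simp only: q_simps Suc lin that)
    also have "\<dots> = (?P * (m - of_nat (Suc n))) *\<^sub>C b"
      by (simp add: left_diff_distrib complex_vector.scale_left_diff_distrib mult.commute
        del: of_nat_Suc)
    finally show ?case by simp
  qed (simp add: q_simps)
  have q_lin: "q n (x + y) = q n x + q n y" "q n (c *\<^sub>C x) = c *\<^sub>C q n x" for n x y c
    by (induction n) (simp_all add: q_simps lin scaleC_simps mult_ac algebra_simps)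
  have "\<exists>N. \<forall>n\<ge>N. q n b = 0" for b
    using span_homogeneous[of b]
  proof (induction rule: complex_vector.span_induct_alt)
    case base
    show ?case using eigen[of 0 0] by (auto simp: lin)
  next
    case (step c x y)
    then obtain m N where m: "m > 0" "degree_derivation x = of_nat m *\<^sub>C x"
      and N: "\<forall>n\<ge>N. q n y = 0" by auto
    have "q n x = 0" if "n \<ge> m" for n
      using m that eigen[OF m(2), of n] by (auto simp: prod_zero_iff intro!: disjI1 bexI[of _ m])
    with N have "\<forall>n\<ge>max N m. q n (c *\<^sub>C x + y) = 0" by (simp add: q_lin)
    then show ?case by blast
  qed
  then obtain N where "q N a = 0" by blast
  then show ?thesis
    using eigen[of a 0 N] assms by auto
qed

text \<open>
  This is the embedding of the free Lie algebra into the free associative algebra, in the form in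
  which an action on functions of words detects it.
\<close>

lemma left_mult_dynkin_separates:
  assumes "left_mult s dynkin [] = left_mult t dynkin []"
  shows "lie_cong {} s t"
proof -
  have "degree_derivation (abs_free_lie_type s - abs_free_lie_type t) = 0"
    by (simp add: complex_linearD(4)[OF complex_linear_degree_derivation] degree_derivation_abs assms)
  then have "abs_free_lie_type s = abs_free_lie_type t"
    using degree_derivation_injective by force
  then show ?thesis by (simp add: free_lie_type.abs_eq_iff)
qed


section \<open>Operators on functions of words\<close>

abbreviation op_bracket :: "('v::complex_vector \<Rightarrow> 'v) \<Rightarrow> ('v \<Rightarrow> 'v) \<Rightarrow> 'v \<Rightarrow> 'v"
  where "op_bracket P Q \<equiv> lie_bracket opposite_gl P Q"

lemma complex_linear_ops:
  "complex_linear 0"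
  "complex_linear P \<Longrightarrow> complex_linear (c *\<^sub>C P)"
  "complex_linear P \<Longrightarrow> complex_linear (- P)"
  by (simp_all add: complex_linear_def scaleC_simps mult.commute)

lemma op_bracket_zero: "complex_linear P \<Longrightarrow> op_bracket P 0 = 0"
  by (simp add: fun_eq_iff complex_linearD(3))

lemma op_bracket_scale:
  "complex_linear P \<Longrightarrow> op_bracket P (c *\<^sub>C Q) = c *\<^sub>C op_bracket P Q"
  "complex_linear P \<Longrightarrow> op_bracket P (- Q) = - op_bracket P Q"
  by (simp_all add: fun_eq_iff complex_linearD(2,5) scaleC_simps)

lemma op_bracket_anticomm: "op_bracket P Q = - op_bracket Q P"
  by (simp add: fun_eq_iff)

text \<open>
  The transpose of an operator \<open>p\<close> on words that kills the empty word and satisfies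
  \<open>p(x w) = [p, x] w + x p(w)\<close>, where \<open>B x\<close> is the transpose of \<open>[p, x]\<close>. If every \<open>[p, x]\<close> is
  the multiplication by a combination of letters, then \<open>p\<close> is a derivation.
\<close>

fun extend :: "('x \<Rightarrow> ('x list \<Rightarrow> 'v) \<Rightarrow> 'x list \<Rightarrow> 'v) \<Rightarrow> ('x list \<Rightarrow> 'v::complex_vector) \<Rightarrow> 'x list \<Rightarrow> 'v"
  where
  "extend B \<phi> [] = 0"
| "extend B \<phi> (x # w) = B x \<phi> w + extend B (shift x \<phi>) w"

lemma shift_extend: "shift x (extend B \<phi>) = B x \<phi> + extend B (shift x \<phi>)"
  by (simp add: fun_eq_iff)

lemma complex_linear_extend:
  assumes "\<And>x. complex_linear (B x)"
  shows "complex_linear (extend B)"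
proof -
  note lin = complex_linearD[OF assms] complex_linearD[OF complex_linear_shift]
  have "extend B (\<phi> + \<psi>) w = extend B \<phi> w + extend B \<psi> w" for \<phi> \<psi> w
    by (induction w arbitrary: \<phi> \<psi>) (simp_all add: lin)
  moreover have "extend B (c *\<^sub>C \<phi>) w = c *\<^sub>C extend B \<phi> w" for c \<phi> w
    by (induction w arbitrary: \<phi>) (simp_all add: lin scaleC_simps)
  ultimately show ?thesis
    by (simp add: complex_linear_def fun_eq_iff)
qed

lemma extend_bracket_shift: "op_bracket (extend B) (shift x) = B x"
  by (simp add: fun_eq_iff)

lemma shift_bracket_extend: "op_bracket (shift x) (extend B) = - B x"
  by (simp add: fun_eq_iff)

lemma extend_scale: "extend (\<lambda>x. c *\<^sub>C B x) = c *\<^sub>C extend B"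
proof -
  have "extend (\<lambda>x. c *\<^sub>C B x) \<phi> w = c *\<^sub>C extend B \<phi> w" for \<phi> w
    by (induction w arbitrary: \<phi>) (simp_all add: scaleC_simps)
  then show ?thesis by (simp add: fun_eq_iff)
qed

lemma extend_zero: "extend (\<lambda>x. 0) = 0"
  using extend_scale[of 0 "\<lambda>x. 0"] by simp

text \<open>
  By the Jacobi identity, \<open>[[p, q], x] = [p, [q, x]] - [q, [p, x]]\<close>; and \<open>[p, q]\<close> kills the empty
  word if \<open>p\<close> and \<open>q\<close> do. So a commutator of such operators is determined letter by letter.
\<close>

lemma extend_bracket_extend:
  assumes "\<And>x. complex_linear (B x)" "\<And>x. complex_linear (B' x)"
    and eq: "\<And>x. op_bracket (extend B) (B' x) - op_bracket (extend B') (B x) = B'' x"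
  shows "op_bracket (extend B) (extend B') = extend B''"
proof -
  note lin = complex_linearD[OF complex_linear_extend[OF assms(1)]]
    complex_linearD[OF complex_linear_extend[OF assms(2)]]
  have "op_bracket (extend B) (extend B') \<phi> w = extend B'' \<phi> w" for \<phi> w
  proof (induction w arbitrary: \<phi>)
    case (Cons x w)
    have "op_bracket (extend B) (extend B') \<phi> (x # w) =
        (op_bracket (extend B) (B' x) - op_bracket (extend B') (B x)) \<phi> w +
        op_bracket (extend B) (extend B') (shift x \<phi>) w"
      by (simp add: shift_extend lin)
    then show ?case
      by (simp only: eq Cons.IH extend.simps)
  qed simp
  then show ?thesis by blast
qed

section \<open>The action of the generators on functions of words\<close>

text \<open>
  The letter \<open>(M, Some i)\<close> stands for the monomial \<open>ad(f)\<^sup>M f\<^sub>i\<close>; the letters \<open>(M, None)\<close> with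
  \<open>M\<close> over \<open>J\<close> span a copy of a Verma module for the subalgebra of \<open>J\<close>,
  with a vector \<open>({#}, None)\<close> of weight \<open>- lam\<close>.
\<close>

type_synonym 'i ad_gen = "'i multiset \<times> 'i option"

locale word_action =
  fixes J :: "'i set" and A :: "'i \<Rightarrow> 'i \<Rightarrow> real" and lam :: "'i \<Rightarrow> complex"
begin

definition end_weight :: "'i \<Rightarrow> 'i option \<Rightarrow> complex"
  where "end_weight i k = (case k of None \<Rightarrow> lam i | Some k \<Rightarrow> A i k)"

text \<open>
  The negative of the weight of a letter. Only members of \<open>J\<close> contribute, although \<open>fst x\<close> may contain
  other elements: in this way the relations hold on all words, not only on the meaningful ones.
\<close>

definition weight :: "'i \<Rightarrow> 'i ad_gen \<Rightarrow> complex"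
  where "weight i x =
    end_weight i (snd x) + (\<Sum>j\<in>#fst x. if j \<in> J then complex_of_real (A i j) else 0)"

definition H_word :: "'i \<Rightarrow> 'i ad_gen \<Rightarrow> ('i ad_gen list \<Rightarrow> 'v::complex_vector) \<Rightarrow> 'i ad_gen list \<Rightarrow> 'v"
  where "H_word i x = (- weight i x) *\<^sub>C shift x"

definition raise_word :: "'i \<Rightarrow> 'i ad_gen \<Rightarrow> ('i ad_gen list \<Rightarrow> 'v::complex_vector) \<Rightarrow> 'i ad_gen list \<Rightarrow> 'v"
  where "raise_word j x = shift (add_mset j (fst x), snd x)"

text \<open>
  Computed from \<open>[e\<^sub>j, f\<^sub>k] = \<delta>\<^sub>j\<^sub>k h\<^sub>j\<close>: as \<open>h\<^sub>j\<close> commutes with \<open>f\<^sub>k\<close> for \<open>k \<in> J\<close>, each of the factors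
  \<open>f\<^sub>j\<close> of the monomial contributes the same scalar.
\<close>

definition lower_word :: "'i \<Rightarrow> 'i ad_gen \<Rightarrow> ('i ad_gen list \<Rightarrow> 'v::complex_vector) \<Rightarrow> 'i ad_gen list \<Rightarrow> 'v"
  where "lower_word j x =
    (- (of_nat (count (fst x) j) * end_weight j (snd x))) *\<^sub>C shift (fst x - {#j#}, snd x)"

text \<open>
  For \<open>i \<notin> J\<close>, the bracket of \<open>e\<^sub>i\<close> with \<open>f\<^sub>i\<close> is \<open>h\<^sub>i\<close>, with \<open>[f\<^sub>l, f\<^sub>i]\<close> it is
  \<open>[f\<^sub>l, h\<^sub>i] = a\<^sub>i\<^sub>l f\<^sub>l\<close>, and with longer monomials it vanishes because the \<open>f\<^sub>l\<close> commute.
\<close>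

definition contract_word :: "'i \<Rightarrow> 'i ad_gen \<Rightarrow> ('i ad_gen list \<Rightarrow> 'v::complex_vector) \<Rightarrow> 'i ad_gen list \<Rightarrow> 'v"
  where "contract_word i x =
    (if x = ({#}, Some i) then extend (H_word i)
     else if \<exists>l\<in>J. x = ({#l#}, Some i)
       then complex_of_real (A i (THE l. x = ({#l#}, Some i))) *\<^sub>C
         extend (raise_word (THE l. x = ({#l#}, Some i)))
     else 0)"

definition H_op where "H_op i = extend (H_word i)"
definition F_op where "F_op i = (if i \<in> J then extend (raise_word i) else shift ({#}, Some i))"
definition E_op where "E_op i = (if i \<in> J then extend (lower_word i) else extend (contract_word i))"

lemma contract_word_simps:
  "contract_word i ({#}, Some i) = extend (H_word i)"
  "l \<in> J \<Longrightarrow> contract_word i ({#l#}, Some i) = complex_of_real (A i l) *\<^sub>C extend (raise_word l)"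
  "x \<noteq> ({#}, Some i) \<Longrightarrow> (\<And>l. l \<in> J \<Longrightarrow> x \<noteq> ({#l#}, Some i)) \<Longrightarrow> contract_word i x = 0"
  by (auto simp: contract_word_def)

lemma contract_word_cases [case_names Nil single other]:
  fixes x :: "'i ad_gen"
  obtains "x = ({#}, Some i)"
  | l where "l \<in> J" "x = ({#l#}, Some i)"
  | "x \<noteq> ({#}, Some i)" "\<And>l. l \<in> J \<Longrightarrow> x \<noteq> ({#l#}, Some i)"
  by blast

lemma complex_linear_word_ops [simp]:
  "complex_linear (H_word i x)" "complex_linear (raise_word i x)" "complex_linear (lower_word i x)"
  "complex_linear (contract_word i x)"
  by (simp_all add: H_word_def raise_word_def lower_word_def contract_word_def complex_linear_ops
    complex_linear_extend)

lemma complex_linear_action [simp]: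
  "complex_linear (H_op i)" "complex_linear (F_op i)" "complex_linear (E_op i)"
  by (simp_all add: H_op_def F_op_def E_op_def complex_linear_extend)

lemma weight_add_mset: "j \<in> J \<Longrightarrow> weight i (add_mset j M, k) = weight i (M, k) + A i j"
  by (simp add: weight_def)

lemma weight_remove: "j \<in> J \<Longrightarrow> j \<in># M \<Longrightarrow> weight i (M - {#j#}, k) = weight i (M, k) - A i j"
  using weight_add_mset[of j i "M - {#j#}" k] by simp

lemmas bracket_simps = op_bracket_scale op_bracket_zero extend_bracket_shift shift_bracket_extend
  complex_linear_extend complex_linear_ops

lemma H_bracket_H: "op_bracket (H_op i) (H_op j) = 0"
proof -
  have "op_bracket (extend (H_word i)) (H_word j x) - op_bracket (extend (H_word j)) (H_word i x) = 0"
    for x :: "'i ad_gen"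
    by (simp add: H_word_def[of _ x] bracket_simps del: opposite_gl_simps) 
       (simp add: H_word_def fun_eq_iff mult.commute)
  from extend_bracket_extend[OF _ _ this]
  show ?thesis by (simp add: H_op_def extend_zero del: opposite_gl_simps)
qed

lemma H_bracket_raise:
  assumes "j \<in> J"
  shows "op_bracket (extend (H_word i)) (extend (raise_word j)) =
    (- complex_of_real (A i j)) *\<^sub>C extend (raise_word j)"
  unfolding extend_scale[symmetric]
proof (rule extend_bracket_extend)
  fix x :: "'i ad_gen"
  show "op_bracket (extend (H_word i)) (raise_word j x) - op_bracket (extend (raise_word j)) (H_word i x) =
    (- complex_of_real (A i j)) *\<^sub>C raise_word j x"
    by (simp add: H_word_def[of _ x] raise_word_def[of _ x] bracket_simps del: opposite_gl_simps)
      (cases x, simp add: H_word_def raise_word_def weight_add_mset assms fun_eq_iff scaleC_simps)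
qed simp_all

lemma H_bracket_lower:
  assumes "j \<in> J"
  shows "op_bracket (extend (H_word i)) (extend (lower_word j)) =
    complex_of_real (A i j) *\<^sub>C extend (lower_word j)"
  unfolding extend_scale[symmetric]
proof (rule extend_bracket_extend)
  fix x :: "'i ad_gen"
  obtain M k where x: "x = (M, k)" by (cases x)
  show "op_bracket (extend (H_word i)) (lower_word j x) - op_bracket (extend (lower_word j)) (H_word i x) =
    complex_of_real (A i j) *\<^sub>C lower_word j x"
  proof (cases "j \<in># M")
    case True
    then show ?thesis
      by (simp add: H_word_def[of _ x] lower_word_def[of _ x] bracket_simps del: opposite_gl_simps)
        (simp add: x H_word_def lower_word_def weight_remove assms fun_eq_iff scaleC_simps algebra_simps)
  next
    case False
    then have "count M j = 0" by (simp add: not_in_iff)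
    then show ?thesis
      by (simp add: H_word_def[of _ x] lower_word_def[of _ x] bracket_simps del: opposite_gl_simps)
        (simp add: x lower_word_def fun_eq_iff)
  qed
qed simp_all

lemma H_bracket_F: "op_bracket (H_op i) (F_op j) = (- complex_of_real (A i j)) *\<^sub>C F_op j"
proof (cases "j \<in> J")
  case True
  then show ?thesis by (simp add: H_op_def F_op_def H_bracket_raise del: opposite_gl_simps)
next
  case False
  then show ?thesis
    by (simp add: H_op_def F_op_def extend_bracket_shift del: opposite_gl_simps)
      (simp add: H_word_def weight_def end_weight_def fun_eq_iff)
qed

lemma H_bracket_E: "op_bracket (H_op i) (E_op j) = complex_of_real (A i j) *\<^sub>C E_op j"
proof (cases "j \<in> J")
  case True
  then show ?thesis by (simp add: H_op_def E_op_def H_bracket_lower del: opposite_gl_simps)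
next
  case False
  have "op_bracket (extend (H_word i)) (extend (contract_word j)) =
      complex_of_real (A i j) *\<^sub>C extend (contract_word j)"
    unfolding extend_scale[symmetric]
  proof (rule extend_bracket_extend)
    fix x :: "'i ad_gen"
    show "op_bracket (extend (H_word i)) (contract_word j x) -
        op_bracket (extend (contract_word j)) (H_word i x) =
      complex_of_real (A i j) *\<^sub>C contract_word j x"
    proof (cases x j rule: contract_word_cases)
      case Nil
      then have c: "contract_word j x = extend (H_word j)"
        by (simp add: contract_word_simps)
      show ?thesis
        by (simp add: H_word_def[of _ x] bracket_simps c H_bracket_H[unfolded H_op_def]
            del: opposite_gl_simps)
          (simp add: Nil weight_def end_weight_def)
    next
      case (single l)
      have w: "weight i x = A i j + A i l"
        using single by (simp add: weight_def end_weight_def)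
      have c: "contract_word j x = complex_of_real (A j l) *\<^sub>C extend (raise_word l)"
        using single by (simp add: contract_word_simps)
      show ?thesis
        by (simp add: H_word_def[of _ x] bracket_simps c w H_bracket_raise[OF single(1)]
            del: opposite_gl_simps)
          (simp add: fun_eq_iff scaleC_simps algebra_simps)
    next
      case other
      then have c: "contract_word j x = 0" by (rule contract_word_simps(3))
      show ?thesis
        by (simp add: c H_word_def[of _ x] bracket_simps del: opposite_gl_simps)
          (simp add: fun_eq_iff)
    qed
  qed simp_all
  with False show ?thesis by (simp only: H_op_def E_op_def if_False)
qed

lemma F_bracket_F:
  assumes "i \<in> J" "j \<in> J"
  shows "op_bracket (F_op i) (F_op j) = 0"
proof -
  have "op_bracket (extend (raise_word i)) (extend (raise_word j)) = extend (\<lambda>x. 0)"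
  proof (rule extend_bracket_extend)
    fix x :: "'i ad_gen"
    show "op_bracket (extend (raise_word i)) (raise_word j x) -
      op_bracket (extend (raise_word j)) (raise_word i x) = 0"
      by (simp add: raise_word_def[of _ x] bracket_simps del: opposite_gl_simps)
        (simp add: raise_word_def add_mset_commute)
  qed simp_all
  with assms show ?thesis by (simp only: F_op_def extend_zero if_True)
qed

lemma E_bracket_E:
  assumes "i \<in> J" "j \<in> J"
  shows "op_bracket (E_op i) (E_op j) = 0"
proof -
  have "op_bracket (extend (lower_word i)) (extend (lower_word j)) = extend (\<lambda>x. 0)"
  proof (rule extend_bracket_extend)
    fix x :: "'i ad_gen"
    show "op_bracket (extend (lower_word i)) (lower_word j x) -
      op_bracket (extend (lower_word j)) (lower_word i x) = 0"
      by (cases "i = j")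
        (simp_all add: lower_word_def[of _ x] bracket_simps del: opposite_gl_simps,
         simp_all add: lower_word_def fun_eq_iff add_mset_commute mult_ac)
  qed simp_all
  with assms show ?thesis by (simp only: E_op_def extend_zero if_True)
qed

lemma E_bracket_F:
  assumes zero: "\<And>i j. i \<in> J \<Longrightarrow> j \<in> J \<Longrightarrow> A i j = 0"
  shows "op_bracket (E_op i) (F_op j) = (if i = j then H_op i else 0)"
proof (cases "i \<in> J"; cases "j \<in> J")
  assume "i \<in> J" "j \<in> J"
  have "op_bracket (extend (lower_word i)) (extend (raise_word j)) =
      extend (\<lambda>x. (if i = j then 1 else 0) *\<^sub>C H_word i x)"
  proof (rule extend_bracket_extend)
    fix x :: "'i ad_gen"
    obtain M k where x: "x = (M, k)" by (cases x)
    have "(\<Sum>l\<in>#M. if l \<in> J then complex_of_real (A i l) else 0) = 0"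
      by (rule sum_mset.neutral) (auto simp: zero \<open>i \<in> J\<close>)
    then have w: "weight i x = end_weight i k"
      by (simp add: weight_def x)
    have "op_bracket (extend (lower_word i)) (raise_word j x) -
        op_bracket (extend (raise_word j)) (lower_word i x) =
      (- (of_nat (count (add_mset j M) i) * end_weight i k)) *\<^sub>C shift (add_mset j M - {#i#}, k) +
      (of_nat (count M i) * end_weight i k) *\<^sub>C shift (add_mset j (M - {#i#}), k)"
      by (simp add: raise_word_def[of _ x] lower_word_def[of _ x] bracket_simps del: opposite_gl_simps)
        (simp add: x raise_word_def lower_word_def)
    also have "\<dots> = (if i = j then 1 else 0) *\<^sub>C H_word i x"
    proof (cases "i = j")
      case False
      then have "add_mset j M - {#i#} = add_mset j (M - {#i#})"
        by (metis add_mset_diff_bothsides diff_add_mset_swap set_mset_single singletonD)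
      with False show ?thesis by simp
    next
      case True
      then show ?thesis
        by (cases "i \<in># M")
          (auto simp: H_word_def w[unfolded x True] x fun_eq_iff scaleC_simps algebra_simps not_in_iff
            dest!: multi_member_split)
    qed
    finally show "op_bracket (extend (lower_word i)) (raise_word j x) -
        op_bracket (extend (raise_word j)) (lower_word i x) =
      (if i = j then 1 else 0) *\<^sub>C H_word i x" .
  qed (simp_all add: complex_linear_ops)
  then show ?thesis using \<open>i \<in> J\<close> \<open>j \<in> J\<close>
    by (cases "i = j")
      (simp_all add: E_op_def F_op_def H_op_def extend_scale extend_zero del: opposite_gl_simps)
next
  assume "i \<in> J" "j \<notin> J"
  then show ?thesis
    by (auto simp add: E_op_def F_op_def extend_bracket_shift simp del: opposite_gl_simps)
      (simp add: lower_word_def fun_eq_iff)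
next
  assume "i \<notin> J" "j \<in> J"
  have "op_bracket (extend (contract_word i)) (extend (raise_word j)) = extend (\<lambda>x. 0)"
  proof (rule extend_bracket_extend)
    fix x :: "'i ad_gen"
    have H: "op_bracket (extend (raise_word j)) (extend (H_word i)) = A i j *\<^sub>C extend (raise_word j)"
      by (subst op_bracket_anticomm) (simp add: H_bracket_raise[OF \<open>j \<in> J\<close>] del: opposite_gl_simps)
    have R: "op_bracket (extend (raise_word j)) (extend (raise_word l)) = 0" if "l \<in> J" for l
      using F_bracket_F[OF \<open>j \<in> J\<close> that] that \<open>j \<in> J\<close> by (simp only: F_op_def if_True)
    show "op_bracket (extend (contract_word i)) (raise_word j x) -
        op_bracket (extend (raise_word j)) (contract_word i x) = 0"
    proof (cases x i rule: contract_word_cases)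
      case Nil
      have c: "op_bracket (extend (contract_word i)) (raise_word j x) =
          complex_of_real (A i j) *\<^sub>C extend (raise_word j)"
        using \<open>j \<in> J\<close>
        by (simp add: raise_word_def[of _ x] bracket_simps del: opposite_gl_simps)
          (simp add: Nil contract_word_simps fun_eq_iff)
      show ?thesis by (simp add: Nil H c[unfolded Nil] contract_word_simps del: opposite_gl_simps)
    next
      case (single l)
      have c1: "contract_word i (add_mset j (fst x), snd x) = 0"
        by (simp add: contract_word_def single)
      have c2: "contract_word i x = complex_of_real (A i l) *\<^sub>C extend (raise_word l)"
        using single by (simp add: contract_word_simps)
      show ?thesis
        by (simp add: c1 c2 R[OF single(1)] raise_word_def[of _ x] bracket_simps
            del: opposite_gl_simps)
          (simp add: fun_eq_iff)
    next
      case other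
      have c1: "contract_word i (add_mset j (fst x), snd x) = 0"
        using other(1) by (auto simp: contract_word_def prod_eq_iff)
      have c2: "contract_word i x = 0" using other by (rule contract_word_simps(3))
      show ?thesis
        by (simp add: c1 c2 raise_word_def[of _ x] bracket_simps del: opposite_gl_simps)
          (simp add: fun_eq_iff)
    qed
  qed simp_all
  with \<open>i \<notin> J\<close> \<open>j \<in> J\<close> show ?thesis
    by (auto simp add: E_op_def F_op_def extend_zero simp del: opposite_gl_simps)
next
  assume "i \<notin> J" "j \<notin> J"
  then show ?thesis
    by (auto simp add: E_op_def F_op_def H_op_def extend_bracket_shift contract_word_def
      simp del: opposite_gl_simps zero_fun_apply)
qed

end

section \<open>Linear spans and Lie closures\<close>

inductive_set linear_span :: "(complex, 'b) lie \<Rightarrow> 'b set \<Rightarrow> 'b set"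
  for L :: "(complex, 'b) lie" and B :: "'b set" where
  base: "x \<in> B \<Longrightarrow> x \<in> linear_span L B"
| zero: "\<zero>\<^bsub>L\<^esub> \<in> linear_span L B"
| add: "x \<in> linear_span L B \<Longrightarrow> y \<in> linear_span L B \<Longrightarrow> x \<oplus>\<^bsub>L\<^esub> y \<in> linear_span L B"
| smult: "x \<in> linear_span L B \<Longrightarrow> c \<odot>\<^bsub>L\<^esub> x \<in> linear_span L B"

inductive_set lie_closure :: "(complex, 'b) lie \<Rightarrow> 'b set \<Rightarrow> 'b set"
  for L :: "(complex, 'b) lie" and B :: "'b set" where
  base: "x \<in> B \<Longrightarrow> x \<in> lie_closure L B"
| zero: "\<zero>\<^bsub>L\<^esub> \<in> lie_closure L B"
| add: "x \<in> lie_closure L B \<Longrightarrow> y \<in> lie_closure L B \<Longrightarrow> x \<oplus>\<^bsub>L\<^esub> y \<in> lie_closure L B"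
| smult: "x \<in> lie_closure L B \<Longrightarrow> c \<odot>\<^bsub>L\<^esub> x \<in> lie_closure L B"
| bracket: "x \<in> lie_closure L B \<Longrightarrow> y \<in> lie_closure L B \<Longrightarrow> lie_bracket L x y \<in> lie_closure L B"

lemma (in module) submodule_iff:
  "submodule H R M \<longleftrightarrow> H \<subseteq> carrier M \<and> \<zero>\<^bsub>M\<^esub> \<in> H \<and>
    (\<forall>x\<in>H. \<forall>y\<in>H. x \<oplus>\<^bsub>M\<^esub> y \<in> H) \<and> (\<forall>a\<in>carrier R. \<forall>x\<in>H. a \<odot>\<^bsub>M\<^esub> x \<in> H)"
proof
  assume H: "submodule H R M"
  then obtain x where "x \<in> H" using submoduleE(2) by blast
  then have "\<zero> \<odot>\<^bsub>M\<^esub> x \<in> H" "\<zero> \<odot>\<^bsub>M\<^esub> x = \<zero>\<^bsub>M\<^esub>"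
    using submoduleE(1,4)[OF H] by auto
  then show "H \<subseteq> carrier M \<and> \<zero>\<^bsub>M\<^esub> \<in> H \<and>
    (\<forall>x\<in>H. \<forall>y\<in>H. x \<oplus>\<^bsub>M\<^esub> y \<in> H) \<and> (\<forall>a\<in>carrier R. \<forall>x\<in>H. a \<odot>\<^bsub>M\<^esub> x \<in> H)"
    using submoduleE[OF H] by auto
next
  assume H: "H \<subseteq> carrier M \<and> \<zero>\<^bsub>M\<^esub> \<in> H \<and>
    (\<forall>x\<in>H. \<forall>y\<in>H. x \<oplus>\<^bsub>M\<^esub> y \<in> H) \<and> (\<forall>a\<in>carrier R. \<forall>x\<in>H. a \<odot>\<^bsub>M\<^esub> x \<in> H)"
  have "\<ominus>\<^bsub>M\<^esub> x \<in> H" if "x \<in> H" for x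
  proof -
    have "(\<ominus> \<one>) \<odot>\<^bsub>M\<^esub> x = \<ominus>\<^bsub>M\<^esub> x"
      using H that smult_l_minus[of \<one> x] smult_one[of x] by auto
    moreover have "(\<ominus> \<one>) \<odot>\<^bsub>M\<^esub> x \<in> H" using H that by blast
    ultimately show ?thesis by simp
  qed
  with H show "submodule H R M" by (intro submoduleI) auto
qed

context lie_algebra
begin

lemma submodule_closed:
  assumes "submodule H complex_field L"
  shows "H \<subseteq> carrier L" "\<zero> \<in> H" "\<And>x y. x \<in> H \<Longrightarrow> y \<in> H \<Longrightarrow> x \<oplus> y \<in> H"
    "\<And>c x. x \<in> H \<Longrightarrow> c \<odot> x \<in> H"
  using assms by (auto simp: submodule_iff)

lemma smult_closed' [simp, intro]: "x \<in> carrier L \<Longrightarrow> c \<odot> x \<in> carrier L"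
  by (rule smult_closed) auto

lemma smult_zero [simp]: "c \<odot> \<zero> = \<zero>" "x \<in> carrier L \<Longrightarrow> 0 \<odot> x = \<zero>"
  using smult_r_null[of c] smult_l_null[of x] by simp_all

lemma smult_minus_one: "x \<in> carrier L \<Longrightarrow> (- 1) \<odot> x = \<ominus> x"
proof -
  assume x: "x \<in> carrier L"
  have "(- 1) \<odot> x \<oplus> x = (- 1 + 1) \<odot> x"
    using x smult_l_distr[of "- 1" 1 x] smult_one[of x] by simp
  then have "(- 1) \<odot> x \<oplus> x = \<zero>" using x by simp
  with x show ?thesis by (metis minus_equality smult_closed')
qed

declare bracket_closed [simp, intro]

lemma linear_span_closed: "B \<subseteq> carrier L \<Longrightarrow> x \<in> linear_span L B \<Longrightarrow> x \<in> carrier L"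
  by (erule linear_span.induct) auto

lemma lie_closure_closed: "B \<subseteq> carrier L \<Longrightarrow> x \<in> lie_closure L B \<Longrightarrow> x \<in> carrier L"
  by (erule lie_closure.induct) auto

lemma submodule_linear_span: "B \<subseteq> carrier L \<Longrightarrow> submodule (linear_span L B) complex_field L"
  by (auto simp: submodule_iff linear_span_closed intro: linear_span.intros)

lemma submodule_lie_closure: "B \<subseteq> carrier L \<Longrightarrow> submodule (lie_closure L B) complex_field L"
  by (auto simp: submodule_iff lie_closure_closed intro: lie_closure.intros)

lemma lie_subalgebra_lie_closure: "B \<subseteq> carrier L \<Longrightarrow> lie_subalgebra (lie_closure L B) L"
  by (auto simp: lie_subalgebra_def submodule_lie_closure intro: lie_closure.bracket)

lemma linear_span_subset:
  assumes "submodule H complex_field L" "B \<subseteq> H" "x \<in> linear_span L B"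
  shows "x \<in> H"
  using assms(3) by induction (use assms(2) submodule_closed[OF assms(1)] in auto)

lemma lie_closure_subset:
  assumes "lie_subalgebra H L" "B \<subseteq> H" "x \<in> lie_closure L B"
  shows "x \<in> H"
  using assms(3) by induction
    (use assms(1,2) submodule_closed[of H] in \<open>auto simp: lie_subalgebra_def\<close>)

lemma lie_generate_eq: "B \<subseteq> carrier L \<Longrightarrow> lie_generate L B = lie_closure L B"
  unfolding lie_generate_def
  using lie_subalgebra_lie_closure lie_closure_subset by (blast intro: lie_closure.base)

lemma bracket_zero [simp]: 
  "x \<in> carrier L \<Longrightarrow> lie_bracket L x \<zero> = \<zero>" "x \<in> carrier L \<Longrightarrow> lie_bracket L \<zero> x = \<zero>"
  using bracket_smult_right[of x \<zero> 0] bracket_smult_left[of \<zero> x 0] by simp_all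

lemma bracket_anticomm:
  assumes "x \<in> carrier L" "y \<in> carrier L"
  shows "lie_bracket L x y = (- 1) \<odot> lie_bracket L y x"
proof -
  have "lie_bracket L (x \<oplus> y) (x \<oplus> y) = lie_bracket L x y \<oplus> lie_bracket L y x"
    using assms bracket_self[of x] bracket_self[of y]
    by (simp add: bracket_add_left bracket_add_right a_comm)
  then have "lie_bracket L x y \<oplus> lie_bracket L y x = \<zero>"
    using assms bracket_self by simp
  then show ?thesis
    using assms by (simp add: smult_minus_one minus_equality)
qed

lemma bracket_derivation:
  assumes "x \<in> carrier L" "y \<in> carrier L" "z \<in> carrier L"
  shows "lie_bracket L x (lie_bracket L y z) =
    lie_bracket L (lie_bracket L x y) z \<oplus> lie_bracket L y (lie_bracket L x z)"
proof -
  let ?a = "lie_bracket L x (lie_bracket L y z)"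
  let ?b = "lie_bracket L (lie_bracket L x y) z"
  let ?c = "lie_bracket L y (lie_bracket L x z)"
  have "lie_bracket L y (lie_bracket L z x) = \<ominus> ?c"
    using assms bracket_smult_right[of y "lie_bracket L x z" "- 1"]
    by (simp add: bracket_anticomm[of z x] smult_minus_one)
  moreover have "lie_bracket L z (lie_bracket L x y) = \<ominus> ?b"
    using assms by (simp add: bracket_anticomm[of z "lie_bracket L x y"] smult_minus_one)
  ultimately have "?a \<oplus> (\<ominus> ?c \<oplus> \<ominus> ?b) = \<zero>"
    using jacobi[OF assms] by simp
  moreover have "\<ominus> ?c \<oplus> \<ominus> ?b = \<ominus> (?b \<oplus> ?c)"
    using assms by (simp add: minus_add a_comm)
  ultimately show ?thesis
    using assms by (metis a_closed a_inv_closed bracket_closed minus_equality minus_minus)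
qed

lemma bracket_linear_span:
  assumes "y \<in> carrier L" "B \<subseteq> carrier L" "submodule H complex_field L"
    and "\<And>x. x \<in> B \<Longrightarrow> lie_bracket L y x \<in> H" "x \<in> linear_span L B"
  shows "lie_bracket L y x \<in> H"
  using assms(5)
proof induction
  case (add x z)
  then show ?case
    using assms submodule_closed[OF assms(3)] by (simp add: bracket_add_right linear_span_closed)
next
  case (smult x c)
  then show ?case
    using assms submodule_closed[OF assms(3)] by (simp add: bracket_smult_right linear_span_closed)
qed (use assms submodule_closed[OF assms(3)] in auto)

lemma linear_span_bracket:
  assumes "y \<in> carrier L" "B \<subseteq> carrier L" "submodule H complex_field L"
    and "\<And>x. x \<in> B \<Longrightarrow> lie_bracket L x y \<in> H" "x \<in> linear_span L B"
  shows "lie_bracket L x y \<in> H"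
  using assms(5)
proof induction
  case (add x z)
  then show ?case
    using assms submodule_closed[OF assms(3)] by (simp add: bracket_add_left linear_span_closed)
next
  case (smult x c)
  then show ?case
    using assms submodule_closed[OF assms(3)] by (simp add: bracket_smult_left linear_span_closed)
qed (use assms submodule_closed[OF assms(3)] in auto)

lemma bracket_lie_closure:
  assumes "y \<in> carrier L" "B \<subseteq> carrier L"
    and "\<And>x. x \<in> B \<Longrightarrow> lie_bracket L y x \<in> lie_closure L B" "x \<in> lie_closure L B"
  shows "lie_bracket L y x \<in> lie_closure L B"
  using assms(4)
proof induction
  case (add x z)
  then show ?case
    using assms by (auto simp: bracket_add_right lie_closure_closed intro: lie_closure.add)
next
  case (smult x c)
  then show ?case
    using assms by (auto simp: bracket_smult_right lie_closure_closed intro: lie_closure.smult)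
next
  case (bracket x z)
  then show ?case
    using assms by (auto simp: bracket_derivation[of y x z] lie_closure_closed
      intro: lie_closure.add lie_closure.bracket)
qed (use assms in \<open>auto intro: lie_closure.zero\<close>)

lemma lie_eval_closed_on: "f \<in> S \<rightarrow> carrier L \<Longrightarrow> t \<in> lie_terms S \<Longrightarrow> lie_eval L f t \<in> carrier L"
  by (induction t) auto

lemma lie_eval_cong_on:
  assumes "lie_cong {} s t" "s \<in> lie_terms S" "t \<in> lie_terms S" "f \<in> S \<rightarrow> carrier L"
  shows "lie_eval L f s = lie_eval L f t"
proof -
  let ?g = "\<lambda>x. if x \<in> S then f x else \<zero>"
  have "lie_eval L ?g s = lie_eval L ?g t"
    by (rule lie_eval_cong[OF assms(1)]) (use assms(4) in auto)
  moreover have "lie_eval L ?g u = lie_eval L f u" if "u \<in> lie_terms S" for u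
    by (rule lie_eval_restrict[OF _ that]) simp
  ultimately show ?thesis using assms(2,3) by simp
qed

lemma lie_closure_eq_eval: "lie_closure L B = lie_eval L (\<lambda>x. x) ` lie_terms B"
proof
  show "lie_closure L B \<subseteq> lie_eval L (\<lambda>x. x) ` lie_terms B"
  proof
    fix x assume "x \<in> lie_closure L B"
    then show "x \<in> lie_eval L (\<lambda>x. x) ` lie_terms B"
    proof induction
      case (base x)
      then show ?case by (intro image_eqI[of _ _ "LGen x"]) simp_all
    next
      case zero
      then show ?case by (intro image_eqI[of _ _ LZero]) simp_all
    next
      case (add x y)
      then obtain s t where "s \<in> lie_terms B" "t \<in> lie_terms B"
        "x = lie_eval L (\<lambda>x. x) s" "y = lie_eval L (\<lambda>x. x) t" by blast
      then show ?case by (intro image_eqI[of _ _ "LAdd s t"]) simp_all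
    next
      case (smult x c)
      then obtain s where "s \<in> lie_terms B" "x = lie_eval L (\<lambda>x. x) s" by blast
      then show ?case by (intro image_eqI[of _ _ "LScale c s"]) simp_all
    next
      case (bracket x y)
      then obtain s t where "s \<in> lie_terms B" "t \<in> lie_terms B"
        "x = lie_eval L (\<lambda>x. x) s" "y = lie_eval L (\<lambda>x. x) t" by blast
      then show ?case by (intro image_eqI[of _ _ "LBracket s t"]) simp_all
    qed
  qed
  have "lie_eval L (\<lambda>x. x) t \<in> lie_closure L B" if "t \<in> lie_terms B" for t
    using that by (induction t) (auto intro: lie_closure.intros)
  then show "lie_eval L (\<lambda>x. x) ` lie_terms B \<subseteq> lie_closure L B" by blast
qed

end

lemma lie_homD:
  assumes "\<phi> \<in> lie_hom L M" "x \<in> carrier L" "y \<in> carrier L"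
  shows "\<phi> x \<in> carrier M" "\<phi> (x \<oplus>\<^bsub>L\<^esub> y) = \<phi> x \<oplus>\<^bsub>M\<^esub> \<phi> y" "\<phi> (c \<odot>\<^bsub>L\<^esub> x) = c \<odot>\<^bsub>M\<^esub> \<phi> x"
    "\<phi> (lie_bracket L x y) = lie_bracket M (\<phi> x) (\<phi> y)"
  using assms by (auto simp: lie_hom_def)

lemma lie_hom_zero:
  assumes "lie_algebra L" "lie_algebra M" "\<phi> \<in> lie_hom L M"
  shows "\<phi> \<zero>\<^bsub>L\<^esub> = \<zero>\<^bsub>M\<^esub>"
proof -
  interpret L: lie_algebra L by fact
  interpret M: lie_algebra M by fact
  show ?thesis
    using lie_homD(3)[OF assms(3), of "\<zero>\<^bsub>L\<^esub>" "\<zero>\<^bsub>L\<^esub>" 0] lie_homD(1)[OF assms(3), of "\<zero>\<^bsub>L\<^esub>" "\<zero>\<^bsub>L\<^esub>"]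
    by simp
qed

lemma lie_hom_eval:
  assumes "lie_algebra L" "lie_algebra M" "\<phi> \<in> lie_hom L M" "f \<in> S \<rightarrow> carrier L" "t \<in> lie_terms S"
  shows "\<phi> (lie_eval L f t) = lie_eval M (\<lambda>x. \<phi> (f x)) t"
proof -
  interpret L: lie_algebra L by fact
  interpret M: lie_algebra M by fact
  show ?thesis using assms(5)
  proof (induction t)
    case LZero
    show ?case using lie_hom_zero[OF assms(1-3)] by simp
  next
    case (LScale c t)
    then show ?case using L.lie_eval_closed_on[OF assms(4)] lie_homD(3)[OF assms(3)] by fastforce
  qed (use L.lie_eval_closed_on[OF assms(4)] lie_homD[OF assms(3)] in simp_all)
qed

lemma lie_hom_class:
  assumes "lie_algebra L" "\<phi> \<in> lie_hom (presented_lie S R) L" "t \<in> lie_terms S"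
  shows "\<phi> (lie_class S R t) = lie_eval L (\<lambda>x. \<phi> (lie_class S R (LGen x))) t"
proof -
  have "lie_eval (presented_lie S R) (\<lambda>x. lie_class S R (LGen x)) t = lie_class S R t"
    using assms(3) by (induction t) (simp_all add: presented_lie_zero presented_lie_ops)
  with lie_hom_eval[OF lie_algebra_presented_lie assms(1,2) _ assms(3), of "\<lambda>x. lie_class S R (LGen x)"]
  show ?thesis by simp
qed

lemma lie_eval_map: "lie_eval L f (map_lie_term g t) = lie_eval L (\<lambda>x. f (g x)) t"
  by (induction t) simp_all

lemma lie_cong_map: "lie_cong {} s t \<Longrightarrow> lie_cong {} (map_lie_term g s) (map_lie_term g t)"
proof (induction rule: lie_cong.induct)
  case (sym s t)
  show ?case by (rule lie_cong.sym[OF sym.IH])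
next
  case (trans s t u)
  then show ?case by (blast intro: lie_cong.trans)
qed (auto intro: lie_cong.intros(2,5-))

lemma map_lie_terms: "g ` S \<subseteq> T \<Longrightarrow> t \<in> lie_terms S \<Longrightarrow> map_lie_term g t \<in> lie_terms T"
  by (auto simp: lie_terms_def lie_term.set_map)

text \<open>
  The canonical map from the presented free Lie algebra onto the Lie closure is evaluation of Lie
  expressions; only its injectivity has to be checked.
\<close>

lemma (in lie_algebra) free_lie_subalgebraI:
  assumes U: "U \<subseteq> carrier L"
    and inj: "\<And>s t. s \<in> lie_terms U \<Longrightarrow> t \<in> lie_terms U \<Longrightarrow>
      lie_eval L (\<lambda>x. x) s = lie_eval L (\<lambda>x. x) t \<Longrightarrow> lie_cong {} s t"
  shows "free_lie_subalgebra L (lie_closure L U) U"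
proof -
  have "\<exists>\<phi> \<in> lie_hom (free_lie U) L. \<forall>x\<in>U. \<phi> (lie_class U {} (LGen x)) = x"
    by (rule presented_lie_universal(1)[OF lie_algebra_axioms]) (use U in auto)
  then obtain \<phi> where \<phi>: "\<phi> \<in> lie_hom (free_lie U) L" "\<And>x. x \<in> U \<Longrightarrow> \<phi> (lie_class U {} (LGen x)) = x"
    by auto
  have eval: "\<phi> (lie_class U {} t) = lie_eval L (\<lambda>x. x) t" if "t \<in> lie_terms U" for t
    unfolding lie_hom_class[OF lie_algebra_axioms \<phi>(1) that]
    by (rule lie_eval_restrict[OF _ that]) (simp add: \<phi>(2))
  have img: "\<phi> ` carrier (free_lie U) = lie_closure L U"
    unfolding carrier_presented_lie lie_closure_eq_eval image_image
    by (rule image_cong[OF HOL.refl eval])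
  have "inj_on \<phi> (carrier (free_lie U))"
    by (auto simp: inj_on_def carrier_presented_lie eval lie_class_eq_iff intro: inj)
  with img have "bij_betw \<phi> (carrier (free_lie U)) (lie_closure L U)"
    by (simp add: bij_betw_def)
  moreover have "\<phi> \<in> lie_hom (free_lie U) (L\<lparr>carrier := lie_closure L U\<rparr>)"
    using \<phi>(1) img by (auto simp: lie_hom_def)
  ultimately show ?thesis
    unfolding free_lie_subalgebra_def lie_iso_def
    using lie_subalgebra_lie_closure[OF U] \<phi>(2) by (auto intro: lie_closure.base)
qed

section \<open>Free subalgebras detected by an action on words\<close>

text \<open>
  A family in \<open>L\<close> whose members act as left multiplication by different letters. Values are in the free
  Lie algebra, so that Dynkin's map is among the functions acted upon.
\<close>

locale free_family = lie_algebra L for L :: "(complex, 'b) lie" (structure) +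
  fixes B :: "'x set" and y :: "'x \<Rightarrow> 'b"
    and \<Theta> :: "'b \<Rightarrow> ('x list \<Rightarrow> 'x free_lie_type) \<Rightarrow> 'x list \<Rightarrow> 'x free_lie_type"
  assumes y_closed: "y ` B \<subseteq> carrier L"
    and \<Theta>_hom: "\<Theta> \<in> lie_hom L opposite_gl"
    and \<Theta>_y: "\<And>x. x \<in> B \<Longrightarrow> \<Theta> (y x) = shift x"
begin

text \<open>
  The index of a member of the family is chosen by \<open>inv_into\<close>; injectivity of the family is a
  consequence of freeness and need not be known here.
\<close>

lemma lift_term:
  assumes "t \<in> lie_terms (y ` B)"
  obtains s where "s \<in> lie_terms B" "map_lie_term y s = t" "\<Theta> (lie_eval L (\<lambda>x. x) t) = left_mult s"
proof -
  let ?s = "map_lie_term (inv_into B y) t"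
  have s: "?s \<in> lie_terms B"
    by (rule map_lie_terms[OF _ assms]) (auto intro: inv_into_into)
  have "map_lie_term y ?s = map_lie_term id t"
    unfolding lie_term.map_comp using assms
    by (intro lie_term.map_cong0) (auto simp: lie_terms_def f_inv_into_f)
  then have t: "map_lie_term y ?s = t" by (simp add: lie_term.map_id)
  have "\<Theta> (lie_eval L (\<lambda>x. x) t) = \<Theta> (lie_eval L y ?s)"
    by (subst (1) t[symmetric]) (simp only: lie_eval_map)
  also have "\<dots> = lie_eval opposite_gl (\<lambda>x. \<Theta> (y x)) ?s"
    using lie_hom_eval[OF lie_algebra_axioms lie_algebra_opposite_gl \<Theta>_hom _ s] y_closed by auto
  also have "\<dots> = left_mult ?s"
    unfolding left_mult_def by (rule lie_eval_restrict[OF \<Theta>_y s])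
  finally show thesis using that s t by blast
qed

lemma separates:
  assumes "s \<in> lie_terms (y ` B)" "t \<in> lie_terms (y ` B)"
    and "\<Theta> (lie_eval L (\<lambda>x. x) s) dynkin [] = \<Theta> (lie_eval L (\<lambda>x. x) t) dynkin []"
  shows "lie_cong {} s t"
proof -
  obtain s' t' where st: "map_lie_term y s' = s" "map_lie_term y t' = t"
    and "left_mult s' dynkin [] = left_mult t' dynkin []"
    using lift_term[OF assms(1)] lift_term[OF assms(2)] assms(3) by metis
  then have "lie_cong {} s' t'"
    by (intro left_mult_dynkin_separates)
  from lie_cong_map[OF this, of y] show ?thesis by (simp add: st)
qed

lemma free_lie_subalgebra_closure: "free_lie_subalgebra L (lie_closure L (y ` B)) (y ` B)"
  by (rule free_lie_subalgebraI[OF y_closed]) (simp add: separates)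

lemma closure_separates:
  assumes "u \<in> lie_closure L (y ` B)" "v \<in> lie_closure L (y ` B)"
    and "\<Theta> u dynkin [] = \<Theta> v dynkin []"
  shows "u = v"
proof -
  obtain s t where st: "s \<in> lie_terms (y ` B)" "u = lie_eval L (\<lambda>x. x) s"
    "t \<in> lie_terms (y ` B)" "v = lie_eval L (\<lambda>x. x) t"
    using assms(1,2) unfolding lie_closure_eq_eval by blast
  then have "lie_cong {} s t"
    using assms(3) by (intro separates) auto
  then show ?thesis
    unfolding st by (rule lie_eval_cong_on) (use st y_closed in auto)
qed

end

section \<open>Elements satisfying the Borcherds relations\<close>

lemma (in lie_algebra) bracket_bracket:
  assumes "x \<in> carrier L" "y \<in> carrier L" "z \<in> carrier L"
  shows "lie_bracket L (lie_bracket L x y) z =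
    lie_bracket L x (lie_bracket L y z) \<oplus> (- 1) \<odot> lie_bracket L y (lie_bracket L x z)"
  using assms by (simp add: bracket_derivation[of x y z] smult_minus_one a_assoc r_neg)

definition ad_word :: "(complex, 'b) lie \<Rightarrow> ('i \<Rightarrow> 'b) \<Rightarrow> 'i list \<Rightarrow> 'i \<Rightarrow> 'b"
  where "ad_word L x js i = foldr (\<lambda>j. lie_bracket L (x j)) js (x i)"

definition ad_words :: "(complex, 'b) lie \<Rightarrow> ('i \<Rightarrow> 'b) \<Rightarrow> 'i set \<Rightarrow> 'i set \<Rightarrow> 'b set"
  where "ad_words L x J K = {ad_word L x js i | js i. set js \<subseteq> J \<and> i \<in> K}"

lemma ad_word_simps [simp]:
  "ad_word L x [] i = x i"
  "ad_word L x (j # js) i = lie_bracket L (x j) (ad_word L x js i)"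
  by (simp_all add: ad_word_def)

lemma ad_wordsI: "set js \<subseteq> J \<Longrightarrow> i \<in> K \<Longrightarrow> ad_word L x js i \<in> ad_words L x J K"
  by (auto simp: ad_words_def)

text \<open>
  The relations of the theorem inside an arbitrary Lie algebra; this covers the Borcherds algebra
  itself, the same algebra with \<open>e\<close> and \<open>f\<close> exchanged, and the operators on functions of words.
\<close>

locale borcherds_triple = lie_algebra L for L :: "(complex, 'b) lie" (structure) +
  fixes I J :: "'i set" and A :: "'i \<Rightarrow> 'i \<Rightarrow> real" and e f h :: "'i \<Rightarrow> 'b"
  assumes J_subset: "J \<subseteq> I"
    and A_zero: "i \<in> J \<Longrightarrow> j \<in> J \<Longrightarrow> A i j = 0"
    and e_closed [simp]: "i \<in> I \<Longrightarrow> e i \<in> carrier L"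
    and f_closed [simp]: "i \<in> I \<Longrightarrow> f i \<in> carrier L"
    and h_closed [simp]: "i \<in> I \<Longrightarrow> h i \<in> carrier L"
    and hh: "i \<in> I \<Longrightarrow> j \<in> I \<Longrightarrow> lie_bracket L (h i) (h j) = \<zero>"
    and he: "i \<in> I \<Longrightarrow> j \<in> I \<Longrightarrow> lie_bracket L (h i) (e j) = complex_of_real (A i j) \<odot> e j"
    and hf: "i \<in> I \<Longrightarrow> j \<in> I \<Longrightarrow> lie_bracket L (h i) (f j) = (- complex_of_real (A i j)) \<odot> f j"
    and ef: "i \<in> I \<Longrightarrow> j \<in> I \<Longrightarrow> lie_bracket L (e i) (f j) = (if i = j then h i else \<zero>)"
    and ee: "i \<in> J \<Longrightarrow> j \<in> J \<Longrightarrow> lie_bracket L (e i) (e j) = \<zero>"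
    and ff: "i \<in> J \<Longrightarrow> j \<in> J \<Longrightarrow> lie_bracket L (f i) (f j) = \<zero>"
begin

lemma J_I [simp]: "j \<in> J \<Longrightarrow> j \<in> I"
  using J_subset by blast

text \<open>
  The Chevalley involution: statements about the \<open>f\<close> part yield those about the \<open>e\<close> part.
\<close>

lemma swap: "borcherds_triple L I J A f e (\<lambda>i. (- 1) \<odot> h i)"
proof unfold_locales
  fix i j assume ij: "i \<in> I" "j \<in> I"
  show "lie_bracket L (f i) (e j) = (if i = j then (- 1) \<odot> h i else \<zero>)"
    using ij by (simp add: bracket_anticomm[of "f i" "e j"] ef)
  have m: "(- 1) \<odot> (c \<odot> x) = (- c) \<odot> x" if "x \<in> carrier L" for c x
    using smult_assoc1[of "- 1" c x] that by simp
  show "lie_bracket L ((- 1) \<odot> h i) (f j) = complex_of_real (A i j) \<odot> f j"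
    "lie_bracket L ((- 1) \<odot> h i) (e j) = (- complex_of_real (A i j)) \<odot> e j"
    "lie_bracket L ((- 1) \<odot> h i) ((- 1) \<odot> h j) = \<zero>"
    using ij by (simp_all add: bracket_smult_left bracket_smult_right hh he hf m)
qed (auto simp: ee ff A_zero)

abbreviation levi_gens :: "'b set" where "levi_gens \<equiv> e ` J \<union> f ` J \<union> h ` I"

abbreviation levi :: "'b set" where "levi \<equiv> linear_span L levi_gens"

abbreviation "neg_words \<equiv> ad_words L f J (I - J)"
abbreviation "pos_words \<equiv> ad_words L e J (I - J)"
abbreviation "neg_part \<equiv> lie_closure L neg_words"
abbreviation "pos_part \<equiv> lie_closure L pos_words"

lemma levi_gens_closed: "levi_gens \<subseteq> carrier L"
  by auto

lemma ad_word_closed: "set js \<subseteq> J \<Longrightarrow> i \<in> I \<Longrightarrow> ad_word L f js i \<in> carrier L"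
  by (induction js) auto

lemma neg_words_closed: "neg_words \<subseteq> carrier L"
  by (auto simp: ad_words_def ad_word_closed)

lemma levi_closed: "x \<in> levi \<Longrightarrow> x \<in> carrier L"
  by (rule linear_span_closed[OF levi_gens_closed])

lemma neg_part_closed: "x \<in> neg_part \<Longrightarrow> x \<in> carrier L"
  by (rule lie_closure_closed[OF neg_words_closed])

lemma levi_gens_bracket:
  assumes "x \<in> levi_gens" "y \<in> levi_gens"
  shows "lie_bracket L x y \<in> levi"
proof -
  note b = linear_span.base linear_span.zero linear_span.smult
  have eh: "lie_bracket L (e j) (h i) = (- 1) \<odot> (complex_of_real (A i j) \<odot> e j)" if "j \<in> J" "i \<in> I" for i j
    using that by (simp add: bracket_anticomm[of "e j" "h i"] he)
  have fh: "lie_bracket L (f j) (h i) = (- 1) \<odot> ((- complex_of_real (A i j)) \<odot> f j)" if "j \<in> J" "i \<in> I" for i j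
    using that by (simp add: bracket_anticomm[of "f j" "h i"] hf)
  have fe: "lie_bracket L (f j) (e i) = (- 1) \<odot> (if i = j then h i else \<zero>)" if "j \<in> J" "i \<in> J" for i j
    using that by (simp add: bracket_anticomm[of "f j" "e i"] ef)
  have hhz: "lie_bracket L (h i) (h j) = \<zero>" if "i \<in> I" "j \<in> I" for i j
    using that by (rule hh)
  show ?thesis
    using assms by (elim UnE imageE) (simp_all add: eh fh fe hh he hf ef ee ff b)
qed

lemma levi_bracket:
  assumes "x \<in> levi" "y \<in> levi"
  shows "lie_bracket L x y \<in> levi"
proof -
  note S = submodule_linear_span[OF levi_gens_closed]
  have "lie_bracket L x z \<in> levi" if "z \<in> levi_gens" for z
    using levi_gens_closed that levi_gens_bracket
    by (intro linear_span_bracket[OF _ levi_gens_closed S _ assms(1)]) auto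
  then show ?thesis
    by (intro bracket_linear_span[OF _ levi_gens_closed S _ assms(2)]) (auto simp: levi_closed assms)
qed

lemma lie_subalgebra_levi: "lie_subalgebra levi L"
  using submodule_linear_span[OF levi_gens_closed] levi_bracket by (simp add: lie_subalgebra_def)

lemma f_bracket_span:
  assumes "j \<in> J" "u \<in> linear_span L neg_words"
  shows "lie_bracket L (f j) u \<in> linear_span L neg_words"
proof (rule bracket_linear_span[OF _ neg_words_closed submodule_linear_span[OF neg_words_closed] _ assms(2)])
  fix x assume "x \<in> neg_words"
  then obtain js i where "set js \<subseteq> J" "i \<in> I - J" "x = ad_word L f js i"
    by (auto simp: ad_words_def)
  moreover from this have "ad_word L f (j # js) i \<in> neg_words"
    using assms(1) by (intro ad_wordsI) auto
  ultimately have "lie_bracket L (f j) x = ad_word L f (j # js) i" "ad_word L f (j # js) i \<in> neg_words"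
    by simp_all
  then show "lie_bracket L (f j) x \<in> linear_span L neg_words"
    by (simp only: linear_span.base)
qed (use assms in simp)

text \<open>
  For \<open>e\<^sub>l\<close> with \<open>l \<in> J\<close>: moving it through \<open>ad f\<^sub>j\<close> produces at most an \<open>h\<^sub>l\<close>, which
  acts diagonally, and at the end it meets \<open>f\<^sub>i\<close> with \<open>i \<noteq> l\<close>, with which it commutes.
\<close>

lemma levi_gens_neg_words:
  assumes "y \<in> levi_gens" "u \<in> neg_words"
  shows "lie_bracket L y u \<in> linear_span L neg_words"
proof -
  obtain js i where js: "set js \<subseteq> J" and i: "i \<in> I - J" and u: "u = ad_word L f js i"
    using assms(2) by (auto simp: ad_words_def)
  have base: "f i \<in> linear_span L neg_words"
    using i ad_wordsI[of "[]" J i "I - J" L f] by (simp add: linear_span.base)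
  have h: "lie_bracket L (h l) (ad_word L f js i) \<in> linear_span L neg_words"
    if "set js \<subseteq> J" "l \<in> I" for l js
    using that(1)
  proof (induction js)
    case Nil
    show ?case using i that(2) base by (auto simp: hf intro: linear_span.smult)
  next
    case (Cons j js)
    have "lie_bracket L (h l) (ad_word L f (j # js) i) =
        (- complex_of_real (A l j)) \<odot> ad_word L f (j # js) i \<oplus>
        lie_bracket L (f j) (lie_bracket L (h l) (ad_word L f js i))"
      using Cons i that(2) by (simp add: bracket_derivation[of "h l" "f j"] ad_word_closed hf bracket_smult_left)
    moreover have "ad_word L f (j # js) i \<in> neg_words"
      using Cons.prems i by (intro ad_wordsI)
    ultimately show ?case
      using Cons by (auto intro!: linear_span.add f_bracket_span intro: linear_span.smult linear_span.base
        simp del: ad_word_simps)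
  qed
  have "lie_bracket L (e l) (ad_word L f js i) \<in> linear_span L neg_words" if "l \<in> J" for l
    using js
  proof (induction js)
    case Nil
    have "l \<noteq> i" using i that by auto
    then show ?case using i that by (auto simp: ef intro: linear_span.zero)
  next
    case (Cons j js)
    have "lie_bracket L (e l) (ad_word L f (j # js) i) =
        (if l = j then lie_bracket L (h l) (ad_word L f js i) else \<zero>) \<oplus>
        lie_bracket L (f j) (lie_bracket L (e l) (ad_word L f js i))"
      using Cons i that by (simp add: bracket_derivation[of "e l" "f j"] ad_word_closed ef)
    moreover have "lie_bracket L (h l) (ad_word L f js i) \<in> linear_span L neg_words"
      using Cons.prems that by (intro h) auto
    ultimately show ?case
      using Cons by (auto intro!: linear_span.add f_bracket_span intro: linear_span.zero
        simp del: ad_word_simps)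
  qed
  then show ?thesis
    using assms(1) h[OF js] f_bracket_span[OF _ linear_span.base[OF assms(2)]] unfolding u by auto
qed

lemma levi_neg_part:
  assumes "y \<in> levi" "u \<in> neg_part"
  shows "lie_bracket L y u \<in> neg_part"
proof (rule bracket_lie_closure[OF levi_closed[OF assms(1)] neg_words_closed _ assms(2)])
  fix u assume u: "u \<in> neg_words"
  have "x \<in> neg_part" if "x \<in> linear_span L neg_words" for x
    by (rule linear_span_subset[OF submodule_lie_closure[OF neg_words_closed] _ that])
      (auto intro: lie_closure.base)
  then have "lie_bracket L z u \<in> neg_part" if "z \<in> levi_gens" for z
    using levi_gens_neg_words[OF that u] by blast
  moreover have "u \<in> carrier L" using u neg_words_closed by blast
  ultimately show "lie_bracket L y u \<in> neg_part"
    by (intro linear_span_bracket[OF _ levi_gens_closed submodule_lie_closure[OF neg_words_closed] _ assms(1)])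
qed

text \<open>
  An \<open>e\<^sub>i\<close> with \<open>i \<notin> J\<close> commutes with all \<open>f\<^sub>j\<close>, \<open>j \<in> J\<close>, so the word becomes
  \<open>ad f\<^sub>j\<^sub>1 \<dots> ad f\<^sub>j\<^sub>n\<close> applied to \<open>h\<^sub>i\<close> or \<open>0\<close>, which stays in the subalgebra \<open>levi\<close>.
\<close>

lemma e_neg_words:
  assumes "i \<in> I - J" "u \<in> neg_words"
  shows "lie_bracket L (e i) u \<in> levi"
proof -
  obtain js k where js: "set js \<subseteq> J" and k: "k \<in> I - J" and u: "u = ad_word L f js k"
    using assms(2) by (auto simp: ad_words_def)
  show ?thesis unfolding u using js
  proof (induction js)
    case Nil
    show ?case using k assms(1) by (auto simp: ef intro: linear_span.zero linear_span.base)
  next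
    case (Cons j js)
    have "i \<noteq> j" using assms(1) Cons.prems by auto
    then have "lie_bracket L (e i) (ad_word L f (j # js) k) =
        lie_bracket L (f j) (lie_bracket L (e i) (ad_word L f js k))"
      using Cons k assms(1) by (simp add: bracket_derivation[of "e i" "f j"] ad_word_closed ef)
    moreover have "f j \<in> levi" using Cons.prems by (auto intro: linear_span.base)
    ultimately show ?case
      using Cons levi_bracket by (simp del: ad_word_simps)
  qed
qed

text \<open>
  Expand a bracket of two elements by the derivation rule; \<open>levi\<close> and \<open>neg_part\<close> both
  map \<open>neg_part\<close> to itself.
\<close>

lemma e_neg_part:
  assumes "i \<in> I - J" "u \<in> neg_part"
  shows "lie_bracket L (e i) u \<in> linear_span L (neg_part \<union> levi)"
  using assms(2)
proof induction
  case (base u)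
  then show ?case using e_neg_words[OF assms(1)] by (auto intro: linear_span.base)
next
  case (add x y)
  then show ?case
    using assms(1) by (auto simp: bracket_add_right neg_part_closed intro: linear_span.add)
next
  case (smult x c)
  then show ?case
    using assms(1) by (auto simp: bracket_smult_right neg_part_closed intro: linear_span.smult)
next
  case (bracket x y)
  have sub: "neg_part \<union> levi \<subseteq> carrier L"
    using neg_part_closed levi_closed by blast
  have *: "lie_bracket L z w \<in> neg_part"
    if "z \<in> linear_span L (neg_part \<union> levi)" "w \<in> neg_part" for z w
    by (rule linear_span_bracket[OF _ sub submodule_lie_closure[OF neg_words_closed] _ that(1)])
      (use that(2) neg_part_closed levi_neg_part in \<open>auto intro: lie_closure.bracket\<close>)
  have "lie_bracket L x (lie_bracket L (e i) y) =
      (- 1) \<odot> lie_bracket L (lie_bracket L (e i) y) x"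
    using bracket assms(1) by (intro bracket_anticomm) (auto simp: neg_part_closed)
  moreover have "lie_bracket L (e i) (lie_bracket L x y) =
      lie_bracket L (lie_bracket L (e i) x) y \<oplus> lie_bracket L x (lie_bracket L (e i) y)"
    using bracket assms(1) by (intro bracket_derivation) (auto simp: neg_part_closed)
  ultimately have "lie_bracket L (e i) (lie_bracket L x y) \<in> neg_part"
    using *[OF bracket.IH(1) bracket.hyps(2)] *[OF bracket.IH(2) bracket.hyps(1)]
    by (simp add: lie_closure.add lie_closure.smult)
  then show ?case by (blast intro: linear_span.base)
qed (use assms in \<open>auto intro: linear_span.zero\<close>)

lemma pos_words_closed: "pos_words \<subseteq> carrier L"
  by (rule borcherds_triple.neg_words_closed[OF swap])

lemma pos_part_closed: "x \<in> pos_part \<Longrightarrow> x \<in> carrier L"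
  by (rule lie_closure_closed[OF pos_words_closed])

lemma gens_levi: "j \<in> J \<Longrightarrow> e j \<in> levi" "j \<in> J \<Longrightarrow> f j \<in> levi" "i \<in> I \<Longrightarrow> h i \<in> levi"
  by (auto intro: linear_span.base)

lemma swap_levi: "linear_span L (f ` J \<union> e ` J \<union> (\<lambda>i. (- 1) \<odot> h i) ` I) = levi"
proof (intro equalityI subsetI)
  fix x assume x: "x \<in> linear_span L (f ` J \<union> e ` J \<union> (\<lambda>i. (- 1) \<odot> h i) ` I)"
  show "x \<in> levi"
    by (rule linear_span_subset[OF submodule_linear_span[OF levi_gens_closed] _ x])
      (auto intro: gens_levi linear_span.smult)
next
  interpret swap: borcherds_triple L I J A f e "\<lambda>i. (- 1) \<odot> h i" by (rule swap)
  fix x assume x: "x \<in> levi"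
  have "h i \<in> swap.levi" if "i \<in> I" for i
  proof -
    have "(- 1) \<odot> ((- 1) \<odot> h i) \<in> swap.levi"
      by (rule linear_span.smult[OF swap.gens_levi(3)[OF that]])
    then show ?thesis using that smult_assoc1[of "- 1" "- 1" "h i"] smult_one[of "h i"] by simp
  qed
  then show "x \<in> swap.levi"
    by (intro linear_span_subset[OF submodule_linear_span[OF swap.levi_gens_closed] _ x])
      (auto intro: linear_span.base)
qed

lemma levi_pos_part:
  assumes "y \<in> levi" "u \<in> pos_part"
  shows "lie_bracket L y u \<in> pos_part"
  using borcherds_triple.levi_neg_part[OF swap] assms swap_levi by simp

abbreviation whole :: "'b set" where "whole \<equiv> linear_span L (neg_part \<union> levi \<union> pos_part)"

lemma parts_closed: "neg_part \<union> levi \<union> pos_part \<subseteq> carrier L"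
  using neg_part_closed levi_closed pos_part_closed by blast

lemma e_bracket_whole:
  assumes "i \<in> I" "x \<in> neg_part \<union> levi \<union> pos_part"
  shows "lie_bracket L (e i) x \<in> whole"
proof (cases "i \<in> J")
  case True
  then have "e i \<in> levi" by (auto intro: linear_span.base)
  with assms(2) show ?thesis
    using levi_neg_part levi_pos_part levi_bracket by (blast intro: linear_span.base)
next
  case False
  then have pos: "e i \<in> pos_part"
    using assms(1) ad_wordsI[of "[]" J i "I - J" L e] by (auto intro: lie_closure.base)
  from assms(2) consider "x \<in> neg_part" | "x \<in> levi" | "x \<in> pos_part" by blast
  then show ?thesis
  proof cases
    case 1
    have "linear_span L (neg_part \<union> levi) \<subseteq> whole"
      using submodule_linear_span[OF parts_closed]
      by (intro subsetI) (erule linear_span_subset[rotated 2], auto intro: linear_span.base)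
    then show ?thesis using e_neg_part[OF _ 1] assms(1) False by blast
  next
    case 2
    have "lie_bracket L (e i) x = (- 1) \<odot> lie_bracket L x (e i)"
      using 2 assms(1) by (intro bracket_anticomm) (auto simp: levi_closed)
    then show ?thesis
      using levi_pos_part[OF 2 pos] by (auto intro: linear_span.base linear_span.smult)
  next
    case 3
    then show ?thesis using pos by (auto intro: linear_span.base lie_closure.bracket)
  qed
qed

text \<open>
  The elements that map \<open>whole\<close> into itself form a subalgebra. It contains the generators, hence it is
  all of \<open>L\<close>, so \<open>whole\<close> is itself a subalgebra, and it contains the generators too.
\<close>

lemma whole_eq:
  assumes gen: "carrier L = lie_closure L (e ` I \<union> f ` I \<union> h ` I)"
  shows "carrier L = whole"
proof -
  note S = submodule_linear_span[OF parts_closed]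
  interpret swap: borcherds_triple L I J A f e "\<lambda>i. (- 1) \<odot> h i" by (rule swap)
  have whole_swap: "swap.whole = whole"
    unfolding swap_levi by (simp add: Un_ac)
  define N where "N = {x \<in> carrier L. \<forall>s\<in>whole. lie_bracket L x s \<in> whole}"
  have closed: "s \<in> carrier L" if "s \<in> whole" for s
    using that by (rule linear_span_closed[OF parts_closed])
  have "lie_subalgebra N L"
    unfolding lie_subalgebra_def submodule_iff
    by (auto simp: N_def bracket_add_left bracket_smult_left bracket_bracket closed
      intro: linear_span.intros)
  moreover have "e ` I \<union> f ` I \<union> h ` I \<subseteq> N"
  proof -
    have "lie_bracket L g s \<in> whole"
      if g: "g \<in> carrier L" "\<And>x. x \<in> neg_part \<union> levi \<union> pos_part \<Longrightarrow> lie_bracket L g x \<in> whole"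
        and s: "s \<in> whole" for g s
      by (rule bracket_linear_span[OF g(1) parts_closed S g(2) s])
    moreover have "lie_bracket L (f i) x \<in> whole"
      if "i \<in> I" "x \<in> neg_part \<union> levi \<union> pos_part" for i x
      using swap.e_bracket_whole[OF that(1), of x] that(2) whole_swap swap_levi by auto
    moreover have "lie_bracket L (h i) x \<in> whole"
      if "i \<in> I" "x \<in> neg_part \<union> levi \<union> pos_part" for i x
    proof -
      have "h i \<in> levi" using that(1) by (auto intro: linear_span.base)
      then show ?thesis
        using that(2) levi_neg_part levi_pos_part levi_bracket by (blast intro: linear_span.base)
    qed
    ultimately show ?thesis
      using e_bracket_whole by (auto simp: N_def)
  qed
  ultimately have N: "carrier L \<subseteq> N"
    unfolding gen using lie_closure_subset by blast
  have "lie_subalgebra whole L"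
    unfolding lie_subalgebra_def using S N closed by (auto simp: N_def)
  moreover have "e ` I \<union> f ` I \<union> h ` I \<subseteq> whole"
  proof -
    have "e i \<in> whole \<and> f i \<in> whole" if "i \<in> I" for i
    proof (cases "i \<in> J")
      case False
      then have "e i \<in> pos_part" "f i \<in> neg_part"
        using that ad_wordsI[of "[]" J i "I - J" L e] ad_wordsI[of "[]" J i "I - J" L f]
        by (auto intro: lie_closure.base)
      then show ?thesis by (auto intro: linear_span.base)
    qed (auto intro: linear_span.base)
    moreover have "h i \<in> whole" if "i \<in> I" for i
      using gens_levi(3)[OF that] by (intro linear_span.base) blast
    ultimately show ?thesis by blast
  qed
  ultimately have "carrier L \<subseteq> whole"
    unfolding gen using lie_closure_subset by blast
  with closed show ?thesis by blast
qed

lemma decompose: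
  assumes "x \<in> whole"
  shows "\<exists>u\<in>neg_part. \<exists>v\<in>levi. \<exists>w\<in>pos_part. x = u \<oplus> v \<oplus> w"
  using assms
proof induction
  case (base x)
  then consider "x \<in> neg_part" | "x \<in> levi" | "x \<in> pos_part" by blast
  then show ?case
  proof cases
    case 1
    then show ?thesis
      by (intro bexI[of _ x] bexI[of _ \<zero>]) (auto simp: neg_part_closed linear_span.zero lie_closure.zero)
  next
    case 2
    then show ?thesis
      by (intro bexI[of _ \<zero> neg_part] bexI[of _ x levi] bexI[of _ \<zero> pos_part])
        (auto simp: levi_closed lie_closure.zero)
  next
    case 3
    then show ?thesis
      by (intro bexI[of _ \<zero> neg_part] bexI[of _ \<zero> levi] bexI[of _ x pos_part])
        (auto simp: pos_part_closed linear_span.zero lie_closure.zero)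
  qed
next
  case zero
  show ?case
    by (intro bexI[of _ \<zero>]) (auto simp: linear_span.zero lie_closure.zero)
next
  case (add x y)
  then obtain u v w u' v' w' where
    uvw: "u \<in> neg_part" "v \<in> levi" "w \<in> pos_part" "x = u \<oplus> v \<oplus> w"
    and uvw': "u' \<in> neg_part" "v' \<in> levi" "w' \<in> pos_part" "y = u' \<oplus> v' \<oplus> w'"
    by blast
  have "x \<oplus> y = (u \<oplus> u') \<oplus> (v \<oplus> v') \<oplus> (w \<oplus> w')"
    using uvw uvw' by (simp add: neg_part_closed levi_closed pos_part_closed a_ac)
  with uvw uvw' show ?case by (blast intro: lie_closure.add linear_span.add)
next
  case (smult x c)
  then obtain u v w where
    uvw: "u \<in> neg_part" "v \<in> levi" "w \<in> pos_part" "x = u \<oplus> v \<oplus> w" by blast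
  then have "c \<odot> x = c \<odot> u \<oplus> c \<odot> v \<oplus> c \<odot> w"
    by (simp add: neg_part_closed levi_closed pos_part_closed smult_r_distr)
  with uvw show ?case by (blast intro: lie_closure.smult linear_span.smult)
qed

end

section \<open>Words and ordered monomials\<close>

context borcherds_triple
begin

lemma ad_word_permute:
  assumes "mset js = mset ks" "set js \<subseteq> J" "i \<in> I"
  shows "ad_word L f js i = ad_word L f ks i"
proof -
  have comm: "lie_bracket L (f j) (lie_bracket L (f k) x) = lie_bracket L (f k) (lie_bracket L (f j) x)"
    if "j \<in> J" "k \<in> J" "x \<in> carrier L" for j k x
    using that by (simp add: bracket_derivation[of "f j" "f k"] ff)
  have "fold (\<lambda>j. lie_bracket L (f j)) (rev js) (f i) = fold (\<lambda>j. lie_bracket L (f j)) (rev ks) (f i)"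
    by (rule fold_permuted_eq[where P = "\<lambda>x. x \<in> carrier L"])
      (use assms comm in \<open>auto simp: subset_iff\<close>)
  then show ?thesis by (simp add: ad_word_def foldr_conv_fold)
qed

end

lemma ad_power_word:
  "(lie_bracket L (x j) ^^ l) (ad_word L x js i) = ad_word L x (replicate l j @ js) i"
  by (induction l) simp_all

lemma foldr_ad_power:
  "foldr (\<lambda>(j, l). lie_bracket L (x j) ^^ l) w (x i) =
    ad_word L x (concat (map (\<lambda>(j, l). replicate l j) w)) i"
proof (induction w)
  case (Cons p w)
  then show ?case by (cases p) (simp add: ad_power_word)
qed simp

lemma sorted_enumeration:
  assumes r: "linear_order_on J r" and "finite S" "S \<subseteq> J"
  shows "\<exists>ks. set ks = S \<and> distinct ks \<and> sorted_wrt (\<lambda>j k. (j, k) \<in> r \<and> j \<noteq> k) ks"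
  using assms(2,3)
proof induction
  case (insert a S)
  then obtain ks where ks: "set ks = S" "distinct ks" "sorted_wrt (\<lambda>j k. (j, k) \<in> r \<and> j \<noteq> k) ks"
    by auto
  have trans: "(x, z) \<in> r" if "(x, y) \<in> r" "(y, z) \<in> r" for x y z
    using r that by (auto simp: order_on_defs elim: transE)
  have anti: "x = y" if "(x, y) \<in> r" "(y, x) \<in> r" for x y
    using r that by (auto simp: order_on_defs dest: antisymD)
  have total: "(x, a) \<in> r \<or> (a, x) \<in> r" if "x \<in> S" for x
    using r that insert.hyps insert.prems by (auto simp: order_on_defs total_on_def)
  let ?ks = "filter (\<lambda>k. (k, a) \<in> r) ks @ a # filter (\<lambda>k. (a, k) \<in> r) ks"
  have "set ?ks = insert a S" using total ks by auto
  moreover have "distinct ?ks" using ks insert.hyps anti by auto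
  moreover have "sorted_wrt (\<lambda>j k. (j, k) \<in> r \<and> j \<noteq> k) ?ks"
    using ks insert.hyps by (auto simp: sorted_wrt_append sorted_wrt_filter intro: trans dest: anti)
  ultimately show ?case by blast
qed simp

lemma count_concat_replicate:
  "distinct ks \<Longrightarrow> count (mset (concat (map (\<lambda>j. replicate (m j) j) ks))) a = (if a \<in> set ks then m a else 0)"
  by (induction ks) auto

text \<open>
  A word may be reordered since the \<open>f\<^sub>j\<close> commute, so its letters can be sorted and
  equal letters collected into a power.
\<close>

lemma (in borcherds_triple) ad_monomials_eq:
  assumes r: "linear_order_on J r"
  shows "ad_monomials L f r J (I - J) = neg_words"
proof (intro equalityI subsetI)
  fix u assume "u \<in> ad_monomials L f r J (I - J)"
  then obtain w i where "set (map fst w) \<subseteq> J" "i \<in> I - J"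
    "u = foldr (\<lambda>(j, l). lie_bracket L (f j) ^^ l) w (f i)"
    unfolding ad_monomials_def by blast
  then show "u \<in> neg_words"
    unfolding foldr_ad_power by (simp only:, intro ad_wordsI) force+
next
  fix u assume "u \<in> neg_words"
  then obtain js i where u: "set js \<subseteq> J" "i \<in> I - J" "u = ad_word L f js i"
    by (auto simp: ad_words_def)
  obtain ks where ks: "set ks = set js" "distinct ks" "sorted_wrt (\<lambda>j k. (j, k) \<in> r \<and> j \<noteq> k) ks"
    using sorted_enumeration[OF r _ u(1)] by auto
  define w where "w = map (\<lambda>j. (j, count (mset js) j)) ks"
  have "mset (concat (map (\<lambda>(j, l). replicate l j) w)) = mset js"
    using ks by (intro multiset_eqI) (auto simp: w_def o_def count_concat_replicate count_eq_zero_iff)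
  then have "u = foldr (\<lambda>(j, l). lie_bracket L (f j) ^^ l) w (f i)"
    unfolding foldr_ad_power u(3) using u ks by (intro ad_word_permute) auto
  moreover have "set (map fst w) \<subseteq> J" "sorted_wrt (\<lambda>j k. (j, k) \<in> r \<and> j \<noteq> k) (map fst w)"
    "\<forall>(j, l) \<in> set w. 0 < l"
    using ks u by (auto simp: w_def o_def)
  ultimately show "u \<in> ad_monomials L f r J (I - J)"
    unfolding ad_monomials_def using u(2) by blast
qed

section \<open>Consequences of the action\<close>

locale acting_triple = borcherds_triple L I J A e f h + word_action J A lam
  for L :: "(complex, 'b) lie" (structure) and I J :: "'i set" and A e f h lam +
  fixes \<Theta> :: "'b \<Rightarrow> ('i ad_gen list \<Rightarrow> 'v::complex_vector) \<Rightarrow> 'i ad_gen list \<Rightarrow> 'v"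
  assumes \<Theta>_hom: "\<Theta> \<in> lie_hom L opposite_gl"
    and \<Theta>_e: "i \<in> I \<Longrightarrow> \<Theta> (e i) = E_op i"
    and \<Theta>_f: "i \<in> I \<Longrightarrow> \<Theta> (f i) = F_op i"
    and \<Theta>_h: "i \<in> I \<Longrightarrow> \<Theta> (h i) = H_op i"
begin

text \<open>
  Bracketing with \<open>f\<^sub>j\<close> raises the letter, as \<open>f\<^sub>j\<close> acts by the derivation which raises letters.
\<close>

lemma \<Theta>_ad_word:
  assumes "set js \<subseteq> J" "i \<in> I - J"
  shows "\<Theta> (ad_word L f js i) = shift (mset js, Some i)"
  using assms(1)
proof (induction js)
  case Nil
  then show ?case using assms(2) by (simp add: \<Theta>_f F_op_def)
next
  case (Cons j js)
  have "\<Theta> (ad_word L f (j # js) i) = op_bracket (\<Theta> (f j)) (\<Theta> (ad_word L f js i))"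
    using Cons.prems assms(2) lie_homD(4)[OF \<Theta>_hom] by (simp add: ad_word_closed del: opposite_gl_simps)
  also have "\<dots> = op_bracket (extend (raise_word j)) (shift (mset js, Some i))"
  proof -
    have "\<Theta> (ad_word L f js i) = shift (mset js, Some i)"
      by (rule Cons.IH) (use Cons.prems in simp)
    moreover have "j \<in> J" using Cons.prems by simp
    ultimately show ?thesis by (simp only: \<Theta>_f F_op_def J_I if_True)
  qed
  also have "\<dots> = shift (mset (j # js), Some i)"
    by (simp only: extend_bracket_shift raise_word_def) (simp add: fun_eq_iff)
  finally show ?case .
qed

text \<open>
  The generators of \<open>levi\<close> and all \<open>e\<^sub>i\<close> kill the empty word, and the operators doing so are closed
  under brackets.
\<close>

lemma vanishing:
  assumes "v \<in> levi \<or> v \<in> pos_part"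
  shows "\<Theta> v \<phi> [] = 0"
proof -
  let ?B = "e ` I \<union> f ` J \<union> h ` I"
  have B: "?B \<subseteq> carrier L" by auto
  note sub = lie_subalgebra_lie_closure[OF B] submodule_lie_closure[OF B]
  have "ad_word L e js i \<in> lie_closure L ?B" if "set js \<subseteq> J" "i \<in> I" for js i
    using that
  proof (induction js)
    case (Cons j js)
    then have "e j \<in> lie_closure L ?B" by (auto intro: lie_closure.base)
    with Cons show ?case by (auto intro: lie_closure.bracket)
  qed (auto intro: lie_closure.base)
  then have "pos_words \<subseteq> lie_closure L ?B"
    by (auto simp: ad_words_def)
  moreover have "levi_gens \<subseteq> lie_closure L ?B"
    by (auto intro: lie_closure.base)
  ultimately have "v \<in> lie_closure L ?B"
    using assms lie_closure_subset[OF sub(1)] linear_span_subset[OF sub(2)] by blast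
  then show ?thesis
  proof (induction arbitrary: \<phi>)
    case (base x)
    then show ?case by (auto simp: \<Theta>_e \<Theta>_f \<Theta>_h E_op_def F_op_def H_op_def)
  next
    case zero
    show ?case using lie_hom_zero[OF lie_algebra_axioms lie_algebra_opposite_gl \<Theta>_hom] by simp
  next
    case (smult x c)
    have "x \<in> carrier L" using smult.hyps by (rule lie_closure_closed[OF B])
    then show ?case using lie_homD(3)[OF \<Theta>_hom, of x x c] smult.IH by simp
  qed (simp_all add: lie_homD[OF \<Theta>_hom] lie_closure_closed[OF B])
qed

end

locale free_acting_triple = acting_triple L I J A e f h lam \<Theta>
  for L :: "(complex, 'b) lie" (structure) and I J :: "'i set" and A e f h lam
    and \<Theta> :: "'b \<Rightarrow> ('i ad_gen list \<Rightarrow> 'i ad_gen free_lie_type) \<Rightarrow> 'i ad_gen list \<Rightarrow> 'i ad_gen free_lie_type"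
begin

text \<open>
  The multiset and not the list is the index, because the operator by which a word acts depends on
  the multiset only.
\<close>

definition gen_index :: "'i ad_gen set"
  where "gen_index = {(mset js, Some i) | js i. set js \<subseteq> J \<and> i \<in> I - J}"

definition gen_word :: "'i ad_gen \<Rightarrow> 'b"
  where "gen_word x = ad_word L f (SOME js. mset js = fst x) (the (snd x))"

lemma gen_word_eq: "set js \<subseteq> J \<Longrightarrow> i \<in> I \<Longrightarrow> gen_word (mset js, Some i) = ad_word L f js i"
proof -
  assume js: "set js \<subseteq> J" "i \<in> I"
  have "mset js = mset (SOME ks. mset ks = mset js)"
    using someI[of "\<lambda>ks. mset ks = mset js" js] by simp
  from ad_word_permute[OF this js] show ?thesis
    by (simp add: gen_word_def)
qed

lemma gen_word_image: "gen_word ` gen_index = neg_words"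
proof (intro equalityI subsetI)
  fix u assume "u \<in> gen_word ` gen_index"
  then obtain js i where "set js \<subseteq> J" "i \<in> I - J" "u = gen_word (mset js, Some i)"
    unfolding gen_index_def by blast
  then show "u \<in> neg_words" by (simp add: gen_word_eq ad_wordsI)
next
  fix u assume "u \<in> neg_words"
  then obtain js i where u: "set js \<subseteq> J" "i \<in> I - J" "u = ad_word L f js i"
    unfolding ad_words_def by blast
  then have "(mset js, Some i) \<in> gen_index" "u = gen_word (mset js, Some i)"
    unfolding gen_index_def by (blast, simp add: gen_word_eq)
  then show "u \<in> gen_word ` gen_index" by blast
qed

sublocale free_family L gen_index gen_word \<Theta>
proof
  show "gen_word ` gen_index \<subseteq> carrier L"
    unfolding gen_word_image by (rule neg_words_closed)
  show "\<Theta> (gen_word x) = shift x" if x: "x \<in> gen_index" for x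
  proof -
    obtain js i where "x = (mset js, Some i)" "set js \<subseteq> J" "i \<in> I - J"
      using x unfolding gen_index_def by blast
    then show ?thesis by (simp add: gen_word_eq \<Theta>_ad_word)
  qed
qed (rule \<Theta>_hom)

lemma free_neg_part: "free_lie_subalgebra L neg_part neg_words"
  using free_lie_subalgebra_closure by (simp only: gen_word_image)

text \<open>
  Applying both sides to Dynkin's map at the empty word leaves only the components in \<open>neg_part\<close>.
\<close>

lemma neg_component_unique:
  assumes "u \<oplus> v \<oplus> w = u' \<oplus> v' \<oplus> w'"
    and "u \<in> neg_part" "v \<in> levi" "w \<in> pos_part" "u' \<in> neg_part" "v' \<in> levi" "w' \<in> pos_part"
  shows "u = u'"
proof -
  have eq: "\<Theta> (u \<oplus> v \<oplus> w) dynkin [] = \<Theta> u dynkin []"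
    if "u \<in> neg_part" "v \<in> levi" "w \<in> pos_part" for u v w
    using that by (simp add: lie_homD[OF \<Theta>_hom] neg_part_closed levi_closed pos_part_closed vanishing)
  show ?thesis
    using assms(2,5) eq[of u v w] eq[of u' v' w'] assms
    by (intro closure_separates) (simp_all add: gen_word_image)
qed

end

section \<open>Presentation of the Borcherds algebra\<close>

context word_action
begin

lemma borcherds_triple_action:
  assumes "J \<subseteq> I" "\<And>i j. i \<in> J \<Longrightarrow> j \<in> J \<Longrightarrow> A i j = 0"
  shows "borcherds_triple (opposite_gl :: (complex, ('i ad_gen list \<Rightarrow> 'v::complex_vector) \<Rightarrow> _) lie)
    I J A E_op F_op H_op"
proof -
  interpret lie_algebra "opposite_gl :: (complex, ('i ad_gen list \<Rightarrow> 'v) \<Rightarrow> _) lie"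
    by (rule lie_algebra_opposite_gl)
  have z: "\<zero>\<^bsub>opposite_gl :: (complex, ('i ad_gen list \<Rightarrow> 'v) \<Rightarrow> _) lie\<^esub> = 0" by simp
  have s: "c \<odot>\<^bsub>opposite_gl\<^esub> P = c *\<^sub>C P" for c and P :: "('i ad_gen list \<Rightarrow> 'v) \<Rightarrow> 'i ad_gen list \<Rightarrow> 'v"
    by simp
  show ?thesis
    by unfold_locales
      (simp_all only: z s H_bracket_H H_bracket_E H_bracket_F E_bracket_F[OF assms(2)] E_bracket_E
        F_bracket_F, use assms in auto)
qed

end

locale borcherds_data =
  fixes I :: "'i set" and A :: "'i \<Rightarrow> 'i \<Rightarrow> real" and J :: "'i set"
  assumes diag: "\<forall>i\<in>I. A i i \<le> 0"
    and J_sub: "J \<subseteq> I"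
    and zero_iff: "\<forall>i\<in>I. \<forall>j\<in>I. A i j = 0 \<longleftrightarrow> i \<in> J \<and> j \<in> J"
begin

text \<open>
  The Serre relations need a positive diagonal entry, and the vanishing entries are those of \<open>J\<close>.
\<close>

lemma relations_eq:
  "borcherds_relations I A =
    (let e = \<lambda>i. LGen (Gen_e i); f = \<lambda>i. LGen (Gen_f i); h = \<lambda>i. LGen (Gen_h i) in
      {(LBracket (h i) (h j), LZero) | i j. i \<in> I \<and> j \<in> I} \<union>
      {(LBracket (h i) (e j), LScale (complex_of_real (A i j)) (e j)) | i j. i \<in> I \<and> j \<in> I} \<union>
      {(LBracket (h i) (f j), LScale (- complex_of_real (A i j)) (f j)) | i j. i \<in> I \<and> j \<in> I} \<union>
      {(LBracket (e i) (f j), if i = j then h i else LZero) | i j. i \<in> I \<and> j \<in> I} \<union>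
      {(LBracket (e i) (e j), LZero) | i j. i \<in> J \<and> j \<in> J} \<union>
      {(LBracket (f i) (f j), LZero) | i j. i \<in> J \<and> j \<in> J})"
proof -
  have serre: "(i \<in> I \<and> j \<in> I \<and> i \<noteq> j \<and> A i i > 0) = False" for i j
    using diag by (auto simp: not_less)
  have zero: "(i \<in> I \<and> j \<in> I \<and> A i j = 0) = (i \<in> J \<and> j \<in> J)" for i j
    using zero_iff J_sub by blast
  show ?thesis
    unfolding borcherds_relations_def Let_def serre zero by simp
qed

lemma relations_cases [consumes 1, case_names hh he hf ef ee ff]:
  assumes "(s, t) \<in> borcherds_relations I A"
  obtains i j where "i \<in> I" "j \<in> I" "s = LBracket (LGen (Gen_h i)) (LGen (Gen_h j))" "t = LZero"
  | i j where "i \<in> I" "j \<in> I" "s = LBracket (LGen (Gen_h i)) (LGen (Gen_e j))"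
      "t = LScale (complex_of_real (A i j)) (LGen (Gen_e j))"
  | i j where "i \<in> I" "j \<in> I" "s = LBracket (LGen (Gen_h i)) (LGen (Gen_f j))"
      "t = LScale (- complex_of_real (A i j)) (LGen (Gen_f j))"
  | i j where "i \<in> I" "j \<in> I" "s = LBracket (LGen (Gen_e i)) (LGen (Gen_f j))"
      "t = (if i = j then LGen (Gen_h i) else LZero)"
  | i j where "i \<in> J" "j \<in> J" "s = LBracket (LGen (Gen_e i)) (LGen (Gen_e j))" "t = LZero"
  | i j where "i \<in> J" "j \<in> J" "s = LBracket (LGen (Gen_f i)) (LGen (Gen_f j))" "t = LZero"
  using assms unfolding relations_eq Let_def by (elim UnE CollectE exE conjE Pair_inject)

lemma relations_intros:
  "i \<in> I \<Longrightarrow> j \<in> I \<Longrightarrow> (LBracket (LGen (Gen_h i)) (LGen (Gen_h j)), LZero) \<in> borcherds_relations I A"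
  "i \<in> I \<Longrightarrow> j \<in> I \<Longrightarrow> (LBracket (LGen (Gen_h i)) (LGen (Gen_e j)),
    LScale (complex_of_real (A i j)) (LGen (Gen_e j))) \<in> borcherds_relations I A"
  "i \<in> I \<Longrightarrow> j \<in> I \<Longrightarrow> (LBracket (LGen (Gen_h i)) (LGen (Gen_f j)),
    LScale (- complex_of_real (A i j)) (LGen (Gen_f j))) \<in> borcherds_relations I A"
  "i \<in> I \<Longrightarrow> j \<in> I \<Longrightarrow> (LBracket (LGen (Gen_e i)) (LGen (Gen_f j)),
    if i = j then LGen (Gen_h i) else LZero) \<in> borcherds_relations I A"
  "i \<in> J \<Longrightarrow> j \<in> J \<Longrightarrow> (LBracket (LGen (Gen_e i)) (LGen (Gen_e j)), LZero) \<in> borcherds_relations I A"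
  "i \<in> J \<Longrightarrow> j \<in> J \<Longrightarrow> (LBracket (LGen (Gen_f i)) (LGen (Gen_f j)), LZero) \<in> borcherds_relations I A"
  unfolding relations_eq Let_def by blast+

lemma gens [simp]:
  "Gen_e i \<in> borcherds_gens I \<longleftrightarrow> i \<in> I" "Gen_f i \<in> borcherds_gens I \<longleftrightarrow> i \<in> I"
  "Gen_h i \<in> borcherds_gens I \<longleftrightarrow> i \<in> I"
  by (auto simp: borcherds_gens_def)

lemma borcherds_triple_borcherds:
  "borcherds_triple (borcherds I A) I J A (borcherds_e I A) (borcherds_f I A) (borcherds_h I A)"
proof -
  note rel = relations_intros[THEN lie_cong.rel]
  interpret lie_algebra "borcherds I A"
    unfolding borcherds_def by (rule lie_algebra_presented_lie)
  have J_I: "j \<in> I" if "j \<in> J" for j using that J_sub by blast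
  note defs = borcherds_def borcherds_e_def borcherds_f_def borcherds_h_def
  show ?thesis
  proof unfold_locales
    fix i j assume ij: "i \<in> I" "j \<in> I"
    show "lie_bracket (borcherds I A) (borcherds_e I A i) (borcherds_f I A j) =
        (if i = j then borcherds_h I A i else \<zero>\<^bsub>borcherds I A\<^esub>)"
    proof -
      have "lie_class (borcherds_gens I) (borcherds_relations I A) (LBracket (LGen (Gen_e i)) (LGen (Gen_f j)))
        = lie_class (borcherds_gens I) (borcherds_relations I A) (if i = j then LGen (Gen_h i) else LZero)"
        by (subst lie_class_eq_iff) (use ij rel(4)[OF ij] in auto)
      then show ?thesis
        using ij by (auto simp: defs presented_lie_zero presented_lie_ops split: if_splits)
    qed
  qed (use J_sub zero_iff in \<open>auto simp: defs presented_lie_ops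
      presented_lie_ops(2)[where t = LZero] presented_lie_zero lie_class_eq_iff J_I rel
      simp del: of_real_minus del: equalityI\<close>)
qed

lemma borcherds_hom:
  assumes "borcherds_triple M I J A e f h"
  shows "\<exists>\<phi> \<in> lie_hom (borcherds I A) M. \<forall>i\<in>I. \<phi> (borcherds_e I A i) = e i \<and>
    \<phi> (borcherds_f I A i) = f i \<and> \<phi> (borcherds_h I A i) = h i"
proof -
  interpret M: borcherds_triple M I J A e f h by fact
  have "\<exists>\<phi> \<in> lie_hom (presented_lie (borcherds_gens I) (borcherds_relations I A)) M.
    \<forall>x\<in>borcherds_gens I. \<phi> (lie_class (borcherds_gens I) (borcherds_relations I A) (LGen x)) =
      case_borcherds_gen e f h x"
  proof (rule presented_lie_universal(1)[OF M.lie_algebra_axioms])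
    show "case_borcherds_gen e f h \<in> borcherds_gens I \<rightarrow> carrier M"
      by (auto simp: borcherds_gens_def)
    show "borcherds_relations I A \<subseteq> lie_terms (borcherds_gens I) \<times> lie_terms (borcherds_gens I)"
    proof (intro subsetI, clarify)
      fix s t assume "(s, t) \<in> borcherds_relations I A"
      then show "s \<in> lie_terms (borcherds_gens I) \<and> t \<in> lie_terms (borcherds_gens I)"
        by (cases rule: relations_cases) (use J_sub in auto)
    qed
    show "lie_eval M (case_borcherds_gen e f h) s = lie_eval M (case_borcherds_gen e f h) t"
      if "(s, t) \<in> borcherds_relations I A" for s t
      using that by (cases rule: relations_cases) (auto simp: M.hh M.he M.hf M.ef M.ee M.ff)
  qed
  then obtain \<phi> where \<phi>: "\<phi> \<in> lie_hom (presented_lie (borcherds_gens I) (borcherds_relations I A)) M"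
    "\<And>x. x \<in> borcherds_gens I \<Longrightarrow>
      \<phi> (lie_class (borcherds_gens I) (borcherds_relations I A) (LGen x)) = case_borcherds_gen e f h x"
    by blast
  have "\<forall>i\<in>I. \<phi> (borcherds_e I A i) = e i \<and> \<phi> (borcherds_f I A i) = f i \<and> \<phi> (borcherds_h I A i) = h i"
    unfolding borcherds_e_def borcherds_f_def borcherds_h_def by (simp add: \<phi>(2))
  with \<phi>(1) show ?thesis
    unfolding borcherds_def by blast
qed

lemma borcherds_generated:
  "carrier (borcherds I A) =
    lie_closure (borcherds I A) (borcherds_e I A ` I \<union> borcherds_f I A ` I \<union> borcherds_h I A ` I)"
  (is "_ = lie_closure _ ?B")
proof -
  interpret borcherds_triple "borcherds I A" I J A "borcherds_e I A" "borcherds_f I A" "borcherds_h I A"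
    by (rule borcherds_triple_borcherds)
  have "lie_class (borcherds_gens I) (borcherds_relations I A) t \<in> lie_closure (borcherds I A) ?B"
    if "t \<in> lie_terms (borcherds_gens I)" for t
    using that
  proof (induction t)
    case (LGen x)
    then show ?case
      by (auto simp: borcherds_gens_def borcherds_e_def borcherds_f_def borcherds_h_def
        intro!: lie_closure.base)
  next
    case LZero
    show ?case
      using lie_closure.zero[of "borcherds I A" ?B] by (simp add: borcherds_def presented_lie_zero)
  next
    case (LAdd s t)
    then show ?case
      using lie_closure.add[of _ "borcherds I A" ?B]
      by (fastforce simp: borcherds_def simp flip: presented_lie_ops)
  next
    case (LScale c s)
    then show ?case
      using lie_closure.smult[of _ "borcherds I A" ?B c]
      by (fastforce simp: borcherds_def presented_lie_ops)
  next
    case (LBracket s t)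
    then show ?case
      using lie_closure.bracket[of _ "borcherds I A" ?B]
      by (fastforce simp: borcherds_def simp flip: presented_lie_ops)
  qed
  then have "carrier (borcherds I A) \<subseteq> lie_closure (borcherds I A) ?B"
    by (auto simp: borcherds_def carrier_presented_lie)
  moreover have "?B \<subseteq> carrier (borcherds I A)" by auto
  ultimately show ?thesis using lie_closure_closed by blast
qed

end

section \<open>Linear independence by dual functionals\<close>

lemma (in lie_algebra) linear_span_finite:
  "x \<in> linear_span L (b ` S) \<Longrightarrow> \<exists>F. finite F \<and> F \<subseteq> S \<and> x \<in> linear_span L (b ` F)"
proof (induction rule: linear_span.induct)
  case (base x)
  then obtain s where "s \<in> S" "x = b s" by blast
  then show ?case by (intro exI[of _ "{s}"]) (auto intro: linear_span.base)
next
  case zero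
  show ?case by (intro exI[of _ "{}"]) (auto intro: linear_span.zero)
next
  case (add x y)
  then obtain F F' where F: "finite F" "F \<subseteq> S" "x \<in> linear_span L (b ` F)"
    "finite F'" "F' \<subseteq> S" "y \<in> linear_span L (b ` F')" by blast
  have mono: "z \<in> linear_span L (b ` (F \<union> F'))" if "z \<in> linear_span L (b ` G)" "G \<subseteq> F \<union> F'" for z G
    using that(1) by induction (use that(2) in \<open>auto intro: linear_span.intros\<close>)
  show ?case
    using F mono[of x F] mono[of y F'] by (intro exI[of _ "F \<union> F'"]) (auto intro: linear_span.add)
next
  case (smult x c)
  then show ?case by (blast intro: linear_span.smult)
qed

lemma (in lie_algebra) dual_family_separates:
  fixes \<zeta> :: "'g \<Rightarrow> 'b \<Rightarrow> complex"
  assumes b: "b ` S \<subseteq> carrier L"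
    and add: "\<And>g x y. g \<in> S \<Longrightarrow> x \<in> carrier L \<Longrightarrow> y \<in> carrier L \<Longrightarrow> \<zeta> g (x \<oplus> y) = \<zeta> g x + \<zeta> g y"
    and smult: "\<And>g x c. g \<in> S \<Longrightarrow> x \<in> carrier L \<Longrightarrow> \<zeta> g (c \<odot> x) = c * \<zeta> g x"
    and dual: "\<And>g g'. g \<in> S \<Longrightarrow> g' \<in> S \<Longrightarrow> \<zeta> g (b g') = (if g = g' then 1 else 0)"
    and x: "x \<in> linear_span L (b ` S)" and zero: "\<And>g. g \<in> S \<Longrightarrow> \<zeta> g x = 0"
  shows "x = \<zero>"
proof -
  have closed: "y \<in> carrier L" if "y \<in> linear_span L (b ` F)" "F \<subseteq> S" for y F
    using that b by (intro linear_span_closed[OF _ that(1)]) blast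
  have \<zeta>_zero: "\<zeta> g \<zero> = 0" if "g \<in> S" for g
    using smult[OF that, of \<zero> 0] by simp
  obtain F where F: "finite F" "F \<subseteq> S" "x \<in> linear_span L (b ` F)"
    using linear_span_finite[OF x] by blast
  then show ?thesis using zero
  proof (induction F arbitrary: x rule: finite_induct)
    case empty
    from empty(2) show ?case by (induction rule: linear_span.induct) auto
  next
    case (insert g F)
    then have gF: "g \<in> S" "F \<subseteq> S" "b g \<in> carrier L" using b by auto
    have "\<exists>c. \<exists>y\<in>linear_span L (b ` F). x = c \<odot> b g \<oplus> y"
      using insert.prems(2)
    proof (induction rule: linear_span.induct)
      case (base x)
      then consider "x = b g" | "x \<in> b ` F" by blast
      then show ?case
      proof cases
        case 1
        then show ?thesis using gF smult_one[of "b g"]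
          by (intro exI[of _ 1] bexI[of _ \<zero>]) (auto intro: linear_span.zero)
      next
        case 2
        then have "x \<in> carrier L" using gF b by blast
        with 2 gF show ?thesis
          by (intro exI[of _ 0] bexI[of _ x]) (auto intro: linear_span.base)
      qed
    next
      case zero
      show ?case using gF by (intro exI[of _ 0] bexI[of _ \<zero>]) (auto intro: linear_span.zero)
    next
      case (add x x')
      then obtain c y c' y' where y: "y \<in> linear_span L (b ` F)" "x = c \<odot> b g \<oplus> y"
        "y' \<in> linear_span L (b ` F)" "x' = c' \<odot> b g \<oplus> y'" by blast
      have "x \<oplus> x' = (c + c') \<odot> b g \<oplus> (y \<oplus> y')"
        using y gF closed[of y F] closed[of y' F] smult_l_distr[of c c' "b g"] by (simp add: a_ac)
      with y show ?case by (blast intro: linear_span.add)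
    next
      case (smult x c)
      then obtain d y where y: "y \<in> linear_span L (b ` F)" "x = d \<odot> b g \<oplus> y" by blast
      have "c \<odot> x = (c * d) \<odot> b g \<oplus> c \<odot> y"
        using y gF closed[of y F] smult_assoc1[of c d "b g"] smult_r_distr[of c] by simp
      with y show ?case by (blast intro: linear_span.smult)
    qed
    then obtain c y where y: "y \<in> linear_span L (b ` F)" "x = c \<odot> b g \<oplus> y" by blast
    have "\<zeta> g y = 0"
      using y(1)
    proof (induction rule: linear_span.induct)
      case (base z)
      then show ?case using dual[OF gF(1)] insert.hyps(2) gF(2) by auto
    qed (use gF \<zeta>_zero add smult closed[OF _ gF(2)] in auto)
    moreover have "\<zeta> g x = c * 1 + \<zeta> g y"
      using y gF closed[OF y(1)] by (simp add: add smult dual)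
    ultimately have "c = 0" using insert.prems(3)[OF gF(1)] by simp
    then have "x = y" using y(2) gF(3) closed[OF y(1) gF(2)] by simp
    then have "x \<in> linear_span L (b ` F)" using y(1) by simp
    from insert.IH[OF gF(2) this insert.prems(3)] show ?case .
  qed
qed

section \<open>The decomposition and the subalgebra of the isotropic indices\<close>

context borcherds_data
begin

lemma triple_J: "borcherds_triple L I J A e f h \<Longrightarrow> borcherds_triple L J J A e f h"
proof -
  assume "borcherds_triple L I J A e f h"
  then interpret borcherds_triple L I J A e f h .
  show ?thesis
    by unfold_locales (simp_all add: hh he hf ef ee ff A_zero)
qed

lemma data_J: "borcherds_data J A J"
  using diag J_sub zero_iff by unfold_locales (blast, blast, metis subsetD)

abbreviation "g \<equiv> borcherds I A"
abbreviation "e \<equiv> borcherds_e I A"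
abbreviation "f \<equiv> borcherds_f I A"
abbreviation "h \<equiv> borcherds_h I A"

sublocale borcherds_triple g I J A e f h
  by (rule borcherds_triple_borcherds)

lemma acting_hom:
  fixes lam :: "'i \<Rightarrow> complex"
  obtains \<Theta> where "acting_triple g I J A e f h lam
    (\<Theta> :: _ \<Rightarrow> ('i ad_gen list \<Rightarrow> 'v::complex_vector) \<Rightarrow> 'i ad_gen list \<Rightarrow> 'v)"
proof -
  interpret word_action J A lam .
  have "borcherds_triple (opposite_gl :: (complex, ('i ad_gen list \<Rightarrow> 'v) \<Rightarrow> _) lie) I J A E_op F_op H_op"
    by (rule borcherds_triple_action[OF J_sub A_zero])
  from borcherds_hom[OF this] obtain \<Theta>
    where "\<Theta> \<in> lie_hom g (opposite_gl :: (complex, ('i ad_gen list \<Rightarrow> 'v) \<Rightarrow> _) lie)"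
      "\<forall>i\<in>I. \<Theta> (e i) = E_op i \<and> \<Theta> (f i) = F_op i \<and> \<Theta> (h i) = H_op i"
    by blast
  then have "acting_triple g I J A e f h lam \<Theta>"
    by unfold_locales auto
  then show thesis by (rule that)
qed

lemma acting_hom_swap:
  fixes lam :: "'i \<Rightarrow> complex"
  obtains \<Theta> where "acting_triple g I J A f e (\<lambda>i. (- 1) \<odot>\<^bsub>g\<^esub> h i) lam
    (\<Theta> :: _ \<Rightarrow> ('i ad_gen list \<Rightarrow> 'v::complex_vector) \<Rightarrow> 'i ad_gen list \<Rightarrow> 'v)"
proof -
  interpret word_action J A lam .
  have "borcherds_triple (opposite_gl :: (complex, ('i ad_gen list \<Rightarrow> 'v) \<Rightarrow> _) lie) I J A E_op F_op H_op"
    by (rule borcherds_triple_action[OF J_sub A_zero])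
  from borcherds_hom[OF borcherds_triple.swap[OF this]] obtain \<Theta>
    where \<Theta>: "\<Theta> \<in> lie_hom g (opposite_gl :: (complex, ('i ad_gen list \<Rightarrow> 'v) \<Rightarrow> _) lie)"
      "\<And>i. i \<in> I \<Longrightarrow> \<Theta> (e i) = F_op i" "\<And>i. i \<in> I \<Longrightarrow> \<Theta> (f i) = E_op i"
      "\<And>i. i \<in> I \<Longrightarrow> \<Theta> (h i) = (- 1) *\<^sub>C H_op i"
    unfolding opposite_gl_simps by blast
  interpret sw: borcherds_triple g I J A f e "\<lambda>i. (- 1) \<odot>\<^bsub>g\<^esub> h i"
    by (rule swap)
  have "acting_triple g I J A f e (\<lambda>i. (- 1) \<odot>\<^bsub>g\<^esub> h i) lam \<Theta>"
  proof unfold_locales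
    fix i assume i: "i \<in> I"
    then have "\<Theta> ((- 1) \<odot>\<^bsub>g\<^esub> h i) = (- 1) *\<^sub>C \<Theta> (h i)"
      using lie_homD(3)[OF \<Theta>(1) h_closed h_closed] by (simp only: opposite_gl_simps)
    then show "\<Theta> ((- 1) \<odot>\<^bsub>g\<^esub> h i) = H_op i"
      by (simp only: \<Theta>(4)[OF i] complex_vector.scale_scale) simp
  qed (rule \<Theta>; assumption)+
  then show thesis by (rule that)
qed

text \<open>
  The components in \<open>neg_part\<close> and \<open>pos_part\<close> are determined by the action and by the action
  composed with the Chevalley involution; then the middle one is determined as well.
\<close>

lemma components_unique:
  assumes "u \<oplus>\<^bsub>g\<^esub> v \<oplus>\<^bsub>g\<^esub> w = u' \<oplus>\<^bsub>g\<^esub> v' \<oplus>\<^bsub>g\<^esub> w'"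
    and uvw: "u \<in> neg_part" "v \<in> levi" "w \<in> pos_part" "u' \<in> neg_part" "v' \<in> levi" "w' \<in> pos_part"
  shows "u = u'" "v = v'" "w = w'"
proof -
  obtain \<Theta> where \<Theta>: "acting_triple g I J A e f h (\<lambda>_. 0)
    (\<Theta> :: _ \<Rightarrow> ('i ad_gen list \<Rightarrow> 'i ad_gen free_lie_type) \<Rightarrow> _)"
    by (rule acting_hom)
  interpret neg: free_acting_triple g I J A e f h "\<lambda>_. 0" \<Theta>
    using \<Theta> by (rule free_acting_triple.intro)
  show u: "u = u'" by (rule neg.neg_component_unique[OF assms])
  obtain \<Theta>' where \<Theta>': "acting_triple g I J A f e (\<lambda>i. (- 1) \<odot>\<^bsub>g\<^esub> h i) (\<lambda>_. 0)
    (\<Theta>' :: _ \<Rightarrow> ('i ad_gen list \<Rightarrow> 'i ad_gen free_lie_type) \<Rightarrow> _)"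
    by (rule acting_hom_swap)
  interpret pos: free_acting_triple g I J A f e "\<lambda>i. (- 1) \<odot>\<^bsub>g\<^esub> h i" "\<lambda>_. 0" \<Theta>'
    using \<Theta>' by (rule free_acting_triple.intro)
  note closed = uvw(1,4)[THEN neg_part_closed] uvw(2,5)[THEN levi_closed] uvw(3,6)[THEN pos_part_closed]
  have flip: "x \<oplus>\<^bsub>g\<^esub> y \<oplus>\<^bsub>g\<^esub> z = z \<oplus>\<^bsub>g\<^esub> y \<oplus>\<^bsub>g\<^esub> x"
    if "x \<in> carrier g" "y \<in> carrier g" "z \<in> carrier g" for x y z
    using that by (simp add: a_ac)
  have "w \<oplus>\<^bsub>g\<^esub> v \<oplus>\<^bsub>g\<^esub> u = w' \<oplus>\<^bsub>g\<^esub> v' \<oplus>\<^bsub>g\<^esub> u'"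
    using assms(1) closed by (simp only: flip)
  then show w: "w = w'"
    by (rule pos.neg_component_unique) (use uvw swap_levi in simp_all)
  show "v = v'"
    using assms(1) closed unfolding u w by simp
qed

lemma free_parts:
  "free_lie_subalgebra g neg_part neg_words" "free_lie_subalgebra g pos_part pos_words"
proof -
  obtain \<Theta> where \<Theta>: "acting_triple g I J A e f h (\<lambda>_. 0)
    (\<Theta> :: _ \<Rightarrow> ('i ad_gen list \<Rightarrow> 'i ad_gen free_lie_type) \<Rightarrow> _)"
    by (rule acting_hom)
  interpret neg: free_acting_triple g I J A e f h "\<lambda>_. 0" \<Theta>
    using \<Theta> by (rule free_acting_triple.intro)
  show "free_lie_subalgebra g neg_part neg_words" by (rule neg.free_neg_part)
  obtain \<Theta>' where \<Theta>': "acting_triple g I J A f e (\<lambda>i. (- 1) \<odot>\<^bsub>g\<^esub> h i) (\<lambda>_. 0)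
    (\<Theta>' :: _ \<Rightarrow> ('i ad_gen list \<Rightarrow> 'i ad_gen free_lie_type) \<Rightarrow> _)"
    by (rule acting_hom_swap)
  interpret pos: free_acting_triple g I J A f e "\<lambda>i. (- 1) \<odot>\<^bsub>g\<^esub> h i" "\<lambda>_. 0" \<Theta>'
    using \<Theta>' by (rule free_acting_triple.intro)
  show "free_lie_subalgebra g pos_part pos_words" by (rule pos.free_neg_part)
qed

lemma ad_monomials_parts:
  assumes "linear_order_on J r"
  shows "ad_monomials g f r J (I - J) = neg_words" "ad_monomials g e r J (I - J) = pos_words"
  using ad_monomials_eq[OF assms] borcherds_triple.ad_monomials_eq[OF swap assms] by simp_all

lemma sub_eq: "borcherds_sub I A J = lie_closure g (e ` J \<union> f ` J \<union> h ` J)"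
  unfolding borcherds_sub_def by (rule lie_generate_eq) auto

lemma levi_eq: "borcherds_sub I A J <+>\<^bsub>g\<^esub> borcherds_cartan I A = levi"
proof -
  have cartan: "borcherds_cartan I A = lie_closure g (h ` I)"
    unfolding borcherds_cartan_def by (rule lie_generate_eq) auto
  let ?s = "lie_closure g (e ` J \<union> f ` J \<union> h ` J)" and ?c = "lie_closure g (h ` I)"
  have B: "e ` J \<union> f ` J \<union> h ` J \<subseteq> carrier g" "h ` I \<subseteq> carrier g" by auto
  have sum: "x \<in> ?s <+>\<^bsub>g\<^esub> ?c \<longleftrightarrow> (\<exists>a\<in>?s. \<exists>b\<in>?c. x = a \<oplus>\<^bsub>g\<^esub> b)" for x
    by (auto simp: set_add_def')
  have gens: "e ` J \<union> f ` J \<union> h ` J \<subseteq> levi" "h ` I \<subseteq> levi"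
    by (auto simp: gens_levi)
  have "?s \<subseteq> levi" "?c \<subseteq> levi"
    using lie_closure_subset[OF lie_subalgebra_levi gens(1)]
      lie_closure_subset[OF lie_subalgebra_levi gens(2)] by (simp_all add: subsetI)
  then have "?s <+>\<^bsub>g\<^esub> ?c \<subseteq> levi"
    by (intro subsetI) (auto simp: sum intro!: linear_span.add)
  moreover have "x \<in> ?s <+>\<^bsub>g\<^esub> ?c" if "x \<in> levi" for x
    using that
  proof induction
    case (base x)
    then consider "x \<in> e ` J \<union> f ` J" | "x \<in> h ` I" by blast
    then show ?case
    proof cases
      case 1
      then show ?thesis unfolding sum
        by (intro bexI[of _ x] bexI[of _ "\<zero>\<^bsub>g\<^esub>"]) (auto intro: lie_closure.base lie_closure.zero)
    next
      case 2
      then show ?thesis unfolding sum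
        by (intro bexI[of _ "\<zero>\<^bsub>g\<^esub>"] bexI[of _ x]) (auto intro: lie_closure.base lie_closure.zero)
    qed
  next
    case zero
    show ?case unfolding sum
      by (intro bexI[of _ "\<zero>\<^bsub>g\<^esub>"]) (auto intro: lie_closure.zero)
  next
    case (add x y)
    then obtain a b a' b' where ab: "a \<in> ?s" "b \<in> ?c" "x = a \<oplus>\<^bsub>g\<^esub> b"
      "a' \<in> ?s" "b' \<in> ?c" "y = a' \<oplus>\<^bsub>g\<^esub> b'" unfolding sum by blast
    have "x \<oplus>\<^bsub>g\<^esub> y = (a \<oplus>\<^bsub>g\<^esub> a') \<oplus>\<^bsub>g\<^esub> (b \<oplus>\<^bsub>g\<^esub> b')"
      using ab lie_closure_closed[OF B(1)] lie_closure_closed[OF B(2)] by (simp add: a_ac)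
    then show ?case unfolding sum
      by (rule bexI[OF bexI[OF _ lie_closure.add[OF ab(2,5)]] lie_closure.add[OF ab(1,4)]])
  next
    case (smult x c)
    then obtain a b where ab: "a \<in> ?s" "b \<in> ?c" "x = a \<oplus>\<^bsub>g\<^esub> b" unfolding sum by blast
    have "c \<odot>\<^bsub>g\<^esub> x = c \<odot>\<^bsub>g\<^esub> a \<oplus>\<^bsub>g\<^esub> c \<odot>\<^bsub>g\<^esub> b"
      using ab lie_closure_closed[OF B(1)] lie_closure_closed[OF B(2)] by (simp add: smult_r_distr)
    then show ?case unfolding sum
      by (rule bexI[OF bexI[OF _ lie_closure.smult[OF ab(2)]] lie_closure.smult[OF ab(1)]])
  qed
  ultimately show ?thesis unfolding sub_eq cartan by blast
qed

lemma direct_sum: "internal_direct_sum3 g neg_part levi pos_part"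
  unfolding internal_direct_sum3_def
proof (intro conjI)
  show "submodule neg_part complex_field g" "submodule levi complex_field g" "submodule pos_part complex_field g"
    by (rule submodule_lie_closure[OF neg_words_closed] submodule_linear_span[OF levi_gens_closed]
      submodule_lie_closure[OF pos_words_closed])+
  have "(\<lambda>(u, v, w). u \<oplus>\<^bsub>g\<^esub> v \<oplus>\<^bsub>g\<^esub> w) ` (neg_part \<times> levi \<times> pos_part) = carrier g"
  proof
    show "(\<lambda>(u, v, w). u \<oplus>\<^bsub>g\<^esub> v \<oplus>\<^bsub>g\<^esub> w) ` (neg_part \<times> levi \<times> pos_part) \<subseteq> carrier g"
      by (auto simp: neg_part_closed levi_closed pos_part_closed)
    show "carrier g \<subseteq> (\<lambda>(u, v, w). u \<oplus>\<^bsub>g\<^esub> v \<oplus>\<^bsub>g\<^esub> w) ` (neg_part \<times> levi \<times> pos_part)"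
      using decompose unfolding whole_eq[OF borcherds_generated] by fastforce
  qed
  moreover have "inj_on (\<lambda>(u, v, w). u \<oplus>\<^bsub>g\<^esub> v \<oplus>\<^bsub>g\<^esub> w) (neg_part \<times> levi \<times> pos_part)"
    unfolding inj_on_def by (clarsimp, intro conjI) (erule (6) components_unique)+
  ultimately show "bij_betw (\<lambda>(u, v, w). u \<oplus>\<^bsub>g\<^esub> v \<oplus>\<^bsub>g\<^esub> w) (neg_part \<times> levi \<times> pos_part) (carrier g)"
    by (simp add: bij_betw_def)
qed

text \<open>
  The algebra of \<open>J\<close> is a sum of Heisenberg algebras with independent central elements. Its span by
  the generators is clear; their images are independent by evaluating the action on the letters
  \<open>({#}, None)\<close> and \<open>({#j#}, None)\<close>.
\<close>

lemma sub_iso: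
  "\<exists>\<phi> \<in> lie_iso (borcherds J A) (g\<lparr>carrier := borcherds_sub I A J\<rparr>).
    \<forall>j\<in>J. \<phi> (borcherds_e J A j) = e j \<and> \<phi> (borcherds_f J A j) = f j \<and>
      \<phi> (borcherds_h J A j) = h j"
proof -
  interpret sub: borcherds_data J A J by (rule data_J)
  let ?gJ = "borcherds J A"
  obtain \<phi> where \<phi>: "\<phi> \<in> lie_hom ?gJ g"
    and \<phi>_gen: "\<And>j. j \<in> J \<Longrightarrow> \<phi> (sub.e j) = e j" "\<And>j. j \<in> J \<Longrightarrow> \<phi> (sub.f j) = f j"
      "\<And>j. j \<in> J \<Longrightarrow> \<phi> (sub.h j) = h j"
    using sub.borcherds_hom[OF triple_J[OF borcherds_triple_borcherds]] by blast
  note hom = lie_homD[OF \<phi>]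
  have \<phi>_zero: "\<phi> \<zero>\<^bsub>?gJ\<^esub> = \<zero>\<^bsub>g\<^esub>"
    by (rule lie_hom_zero[OF sub.lie_algebra_axioms lie_algebra_axioms \<phi>])
  have gens_closed: "sub.e ` J \<union> sub.f ` J \<union> sub.h ` J \<subseteq> carrier ?gJ"
    by auto
  have image: "\<phi> ` carrier ?gJ = borcherds_sub I A J"
  proof (intro equalityI subsetI)
    fix y assume "y \<in> \<phi> ` carrier ?gJ"
    then obtain x where x: "x \<in> lie_closure ?gJ (sub.e ` J \<union> sub.f ` J \<union> sub.h ` J)" "y = \<phi> x"
      unfolding sub.borcherds_generated by blast
    from x(1) have "\<phi> x \<in> borcherds_sub I A J"
      unfolding sub_eq
    proof induction
      case (base x)
      then show ?case by (auto simp: \<phi>_gen intro: lie_closure.base)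
    next
      case (smult x c)
      have "x \<in> carrier ?gJ" by (rule sub.lie_closure_closed[OF gens_closed smult.hyps])
      then show ?case using hom(3)[of x x c] smult.IH by (simp add: lie_closure.smult)
    qed (simp_all add: \<phi>_zero hom sub.lie_closure_closed[OF gens_closed]
      lie_closure.zero lie_closure.add lie_closure.bracket)
    then show "y \<in> borcherds_sub I A J" by (simp only: x(2))
  next
    fix y assume "y \<in> borcherds_sub I A J"
    then show "y \<in> \<phi> ` carrier ?gJ"
      unfolding sub_eq
    proof induction
      case (base y)
      then consider j where "j \<in> J" "y = e j" | j where "j \<in> J" "y = f j" | j where "j \<in> J" "y = h j"
        by blast
      then show ?case
        by cases (auto simp: \<phi>_gen(1)[symmetric] \<phi>_gen(2)[symmetric] \<phi>_gen(3)[symmetric])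
    next
      case zero
      show ?case unfolding \<phi>_zero[symmetric] by (rule imageI) simp
    next
      case (add x y)
      then obtain x' y' where xy: "x' \<in> carrier ?gJ" "y' \<in> carrier ?gJ" "x = \<phi> x'" "y = \<phi> y'" by blast
      show ?case unfolding xy(3,4) hom(2)[OF xy(1,2), symmetric] by (rule imageI) (use xy in simp)
    next
      case (smult x c)
      then obtain x' where x: "x' \<in> carrier ?gJ" "x = \<phi> x'" by blast
      show ?case unfolding x(2) hom(3)[OF x(1,1), symmetric] by (rule imageI) (use x in simp)
    next
      case (bracket x y)
      then obtain x' y' where xy: "x' \<in> carrier ?gJ" "y' \<in> carrier ?gJ" "x = \<phi> x'" "y = \<phi> y'" by blast
      show ?case unfolding xy(3,4) hom(4)[OF xy(1,2), symmetric] by (rule imageI) (use xy in simp)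
    qed
  qed
  have "\<forall>lam. \<exists>\<Theta>. acting_triple g I J A e f h lam
    (\<Theta> :: _ \<Rightarrow> ('i ad_gen list \<Rightarrow> complex) \<Rightarrow> 'i ad_gen list \<Rightarrow> complex)"
    using acting_hom by blast
  then obtain \<Theta> where \<Theta>: "\<And>lam. acting_triple g I J A e f h lam
    (\<Theta> lam :: _ \<Rightarrow> ('i ad_gen list \<Rightarrow> complex) \<Rightarrow> 'i ad_gen list \<Rightarrow> complex)"
    by metis
  define \<delta> :: "'i multiset \<Rightarrow> 'i ad_gen list \<Rightarrow> complex"
    where "\<delta> M w = (if w = [(M, None)] then 1 else 0)" for M w
  \<comment> \<open>The free weight \<open>lam\<close> makes the functionals dual to the generators: \<open>lam\<close> concentrated at \<open>j\<close>
    separates \<open>h\<^sub>j\<close> from the other central elements, and \<open>lam\<close> nowhere zero makes each \<open>e\<^sub>j\<close> act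
    nontrivially.\<close>
  define \<zeta> where "\<zeta> k x = (case k of
      Gen_e j \<Rightarrow> \<Theta> (\<lambda>_. - 1) (\<phi> x) (\<delta> {#}) [({#j#}, None)]
    | Gen_f j \<Rightarrow> \<Theta> (\<lambda>_. 0) (\<phi> x) (\<delta> {#j#}) [({#}, None)]
    | Gen_h j \<Rightarrow> \<Theta> (\<lambda>i. if i = j then - 1 else 0) (\<phi> x) (\<delta> {#}) [({#}, None)])"
    for k :: "'i borcherds_gen" and x
  define b where "b k = (case k of Gen_e j \<Rightarrow> sub.e j | Gen_f j \<Rightarrow> sub.f j | Gen_h j \<Rightarrow> sub.h j)"
    for k :: "'i borcherds_gen"
  note \<Theta>_hom = lie_homD[OF acting_triple.\<Theta>_hom[OF \<Theta>]]
  have b_image: "b ` borcherds_gens J = sub.e ` J \<union> sub.f ` J \<union> sub.h ` J"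
    by (simp add: borcherds_gens_def image_Un image_image b_def)
  have \<zeta>_add: "\<zeta> k (x \<oplus>\<^bsub>?gJ\<^esub> y) = \<zeta> k x + \<zeta> k y" if "x \<in> carrier ?gJ" "y \<in> carrier ?gJ" for k x y
    using that by (simp add: \<zeta>_def hom \<Theta>_hom split: borcherds_gen.split)
  have \<zeta>_smult: "\<zeta> k (c \<odot>\<^bsub>?gJ\<^esub> x) = c * \<zeta> k x" if "x \<in> carrier ?gJ" for k c x
    using that by (simp add: \<zeta>_def hom(3)[OF that that] \<Theta>_hom(3)[OF hom(1,1)[OF that that]]
      scaleC_complex_def split: borcherds_gen.split)
  note ops = acting_triple.\<Theta>_e[OF \<Theta>] acting_triple.\<Theta>_f[OF \<Theta>] acting_triple.\<Theta>_h[OF \<Theta>]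
    word_action.E_op_def word_action.F_op_def word_action.H_op_def word_action.lower_word_def
    word_action.raise_word_def word_action.H_word_def word_action.weight_def word_action.end_weight_def
  have dual: "\<zeta> k (b k') = (if k = k' then 1 else 0)"
    if "k \<in> borcherds_gens J" "k' \<in> borcherds_gens J" for k k'
    using that by (cases k; cases k') (auto simp: \<zeta>_def b_def \<phi>_gen ops \<delta>_def scaleC_complex_def)
  have injective: "x = \<zero>\<^bsub>?gJ\<^esub>" if x: "x \<in> carrier ?gJ" and "\<phi> x = \<zero>\<^bsub>g\<^esub>" for x
  proof (rule sub.dual_family_separates[where b = b and S = "borcherds_gens J" and \<zeta> = \<zeta>])
    have "x \<in> lie_closure ?gJ (sub.e ` J \<union> sub.f ` J \<union> sub.h ` J)"
      using x unfolding sub.borcherds_generated .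
    then show "x \<in> linear_span ?gJ (b ` borcherds_gens J)"
      unfolding b_image
      by (rule sub.lie_closure_subset[OF sub.lie_subalgebra_levi, rotated]) (auto intro: linear_span.base)
    have "\<Theta> lam \<zero>\<^bsub>g\<^esub> = 0" for lam
      using lie_hom_zero[OF lie_algebra_axioms lie_algebra_opposite_gl acting_triple.\<Theta>_hom[OF \<Theta>]] by simp
    then show "\<zeta> k x = 0" for k
      using that(2) by (simp add: \<zeta>_def split: borcherds_gen.split)
  qed (use b_image gens_closed \<zeta>_add \<zeta>_smult dual in auto)
  have "inj_on \<phi> (carrier ?gJ)"
  proof (rule inj_onI)
    fix x y assume xy: "x \<in> carrier ?gJ" "y \<in> carrier ?gJ" "\<phi> x = \<phi> y"
    have y': "(- 1) \<odot>\<^bsub>?gJ\<^esub> y \<in> carrier ?gJ" using xy by simp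
    have "\<phi> (x \<oplus>\<^bsub>?gJ\<^esub> (- 1) \<odot>\<^bsub>?gJ\<^esub> y) = \<phi> y \<oplus>\<^bsub>g\<^esub> (- 1) \<odot>\<^bsub>g\<^esub> \<phi> y"
      using hom(2)[OF xy(1) y'] hom(3)[OF xy(2,2)] xy(3) by simp
    also have "\<dots> = \<zero>\<^bsub>g\<^esub>"
      using hom(1)[OF xy(2,2)] by (simp add: smult_minus_one r_neg)
    finally have "x \<oplus>\<^bsub>?gJ\<^esub> (- 1) \<odot>\<^bsub>?gJ\<^esub> y = \<zero>\<^bsub>?gJ\<^esub>"
      using xy(1) y' by (intro injective) auto
    then show "x = y"
      using xy(1,2) by (simp add: sub.smult_minus_one) (metis sub.minus_equality sub.minus_minus sub.a_inv_closed)
  qed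
  with image have "bij_betw \<phi> (carrier ?gJ) (borcherds_sub I A J)"
    by (simp add: bij_betw_def)
  moreover have "\<phi> \<in> lie_hom ?gJ (g\<lparr>carrier := borcherds_sub I A J\<rparr>)"
    using \<phi> image by (auto simp: lie_hom_def)
  ultimately show ?thesis
    using \<phi>_gen by (auto simp: lie_iso_def)
qed

end

theorem theorem3p3:
  fixes I :: "'i set" and A :: "'i \<Rightarrow> 'i \<Rightarrow> real" and J :: "'i set" and r :: "'i rel"
  assumes "countable I"
    and "symmetrized_borcherds_cartan I A"
    and "\<forall>i\<in>I. A i i \<le> 0"
    and "J = {j \<in> I. A j j = 0}"
    and "\<forall>i\<in>I. \<forall>j\<in>I. A i j = 0 \<longleftrightarrow> i \<in> J \<and> j \<in> J"
    and "linear_order_on J r"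
  shows "(\<exists>u_plus u_minus.
      free_lie_subalgebra (borcherds I A) u_plus
        (ad_monomials (borcherds I A) (borcherds_e I A) r J (I - J)) \<and>
      free_lie_subalgebra (borcherds I A) u_minus
        (ad_monomials (borcherds I A) (borcherds_f I A) r J (I - J)) \<and>
      internal_direct_sum3 (borcherds I A)
        u_minus
        (borcherds_sub I A J <+>\<^bsub>borcherds I A\<^esub> borcherds_cartan I A)
        u_plus) \<and>
    (\<exists>\<phi> \<in> lie_iso (borcherds J A) ((borcherds I A)\<lparr>carrier := borcherds_sub I A J\<rparr>).
      \<forall>j\<in>J. \<phi> (borcherds_e J A j) = borcherds_e I A j \<and>
        \<phi> (borcherds_f J A j) = borcherds_f I A j \<and>
        \<phi> (borcherds_h J A j) = borcherds_h I A j)"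
proof -
  interpret borcherds_data I A J
  proof
    show "J \<subseteq> I" unfolding assms(4) by blast
  qed (fact assms(3), fact assms(5))
  show ?thesis
    unfolding ad_monomials_parts[OF assms(6)] levi_eq
    by (intro conjI exI[of _ pos_part] exI[of _ neg_part] free_parts direct_sum sub_iso)
qed

end
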